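(* For every even integer $n>2$ there exists a latin square of order $n$ which has a $k$-plex for every odd integer $k$ with $\lfloor n/4\rfloor\le k\le\lceil 3n/4\rceil$, but has no $k$-plex for any odd integer $k$ outside this range.
   Context: A latin square of order $n$ is an $n\times n$ array of $n$ symbols in which each symbol occurs exactly once in each row and column. A $k$-plex in a latin square of order $n$ is a set of $kn$ cells containing exactly $k$ cells from each row, exactly $k$ cells from each column, and exactly $k$ occurrences of each symbol. *)

theory Defs
  imports Complex_Main
begin

definition latin_square :: "nat \<Rightarrow> (nat \<Rightarrow> nat \<Rightarrow> nat) \<Rightarrow> bool" where
  "latin_square n L \<longleftrightarrow>
     (\<forall>i<n. \<forall>j<n. L i j < n) \<and>
     (\<forall>i<n. \<forall>s<n. card {j. j < n \<and> L i j = s} = 1) \<and>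
     (\<forall>j<n. \<forall>s<n. card {i. i < n \<and> L i j = s} = 1)"

definition is_kplex :: "nat \<Rightarrow> (nat \<Rightarrow> nat \<Rightarrow> nat) \<Rightarrow> nat \<Rightarrow> (nat \<times> nat) set \<Rightarrow> bool" where
  "is_kplex n L k P \<longleftrightarrow>
     P \<subseteq> {0..<n} \<times> {0..<n} \<and> card P = k * n \<and>
     (\<forall>i<n. card {j. (i, j) \<in> P} = k) \<and>
     (\<forall>j<n. card {i. (i, j) \<in> P} = k) \<and>
     (\<forall>s<n. card {c \<in> P. L (fst c) (snd c) = s} = k)"

definition has_kplex :: "nat \<Rightarrow> (nat \<Rightarrow> nat \<Rightarrow> nat) \<Rightarrow> nat \<Rightarrow> bool" where
  "has_kplex n L k \<longleftrightarrow> (\<exists>P. is_kplex n L k P)"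

end

theory Submission
  imports Defs
begin

text \<open>
  Let \<open>n = 2h\<close>. The square is the addition table of \<open>\<int>/n\<close> in which rows 0 and 2 exchange their entries
  in the odd columns; if \<open>h\<close> is odd, one intercalate in rows 1 and 2 is switched as well. Sum
  symbol minus row minus column over the cells of a \<open>k\<close>-plex with \<open>k\<close> odd: modulo \<open>n\<close> the result is
  \<open>h\<close>. On the other hand row 0 contributes between \<open>0\<close> and \<open>2k\<close>, row 2 between \<open>-2k\<close> and \<open>0\<close>, row 1
  at most \<open>h mod 2\<close> in absolute value, and the other rows nothing. Hence \<open>h \<le> 2k + h mod 2\<close>, which is
  the lower bound on \<open>k\<close>; the upper bound follows by taking complements.

  Conversely let \<open>h = 4T + g\<close> with \<open>g < 4\<close> and \<open>k = 2T + 1 + 2E \<le> h\<close>. A diagonal of even shift together with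
  one of odd shift (adapted to the exchanged entries) is a 2-plex. Take \<open>T\<close> such pairs and a near
  transversal which follows a diagonal of odd shift and then one of even shift, so that it
  misses one column and meets another one twice. Rearranging the cells of the \<open>T\<close> pairs in rows 0
  and 2 contributes \<open>4T\<close> to the defect \<open>h\<close>, the near transversal and the intercalate contribute the
  remaining \<open>g\<close>. The rearrangement increases \<open>T\<close> odd and \<open>T\<close> even symbols by 2; moving suitable
  cells two columns to the left, along a sequence of columns of equal parity, decreases these
  symbols again and at the same time carries the doubled column to the missing one. Finally add \<open>E\<close> further
  pairs of diagonals.
\<close>

section \<open>The latin square\<close>

lemma card_fibre_inj:
  fixes f :: "nat \<Rightarrow> nat"
  assumes "inj_on f {..<n}" "\<And>x. x < n \<Longrightarrow> f x < n" "s < n"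
  shows "card {x. x < n \<and> f x = s} = 1"
proof -
  have "f ` {..<n} = {..<n}"
    using assms by (intro endo_inj_surj) auto
  then obtain x where x: "x < n" "f x = s"
    using assms(3) by (metis imageE lessThan_iff)
  have "{x. x < n \<and> f x = s} = {x}"
    using x assms(1) by (auto dest: inj_onD)
  then show ?thesis by simp
qed

definition base_square :: "nat \<Rightarrow> nat \<Rightarrow> nat \<Rightarrow> nat" where
  "base_square n i j =
     (if odd j \<and> i = 0 then j + 2 else if odd j \<and> i = 2 then j else i + j) mod n"

text \<open>For every even column \<open>q\<close> the cells of rows 1, 2 and columns
  \<open>q\<close>, \<open>q + 1\<close> form an intercalate of \<open>base_square n\<close>. The value of \<open>q\<close> is the one that fits the
  plexes constructed below.\<close>

definition flip_col :: "nat \<Rightarrow> nat" where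
  "flip_col n = (if n mod 8 = 2 then 0 else 4)"

definition swap_cols :: "nat \<Rightarrow> nat \<Rightarrow> nat" where
  "swap_cols n j =
     (if j = flip_col n then flip_col n + 1 else if j = flip_col n + 1 then flip_col n else j)"

definition plex_square :: "nat \<Rightarrow> nat \<Rightarrow> nat \<Rightarrow> nat" where
  "plex_square n i j =
     base_square n i (if n mod 4 = 2 \<and> (i = 1 \<or> i = 2) then swap_cols n j else j)"

lemma mod_lt_twice: "x < 2 * n \<Longrightarrow> x mod n = (if x < n then x else x - (n::nat))"
  by (simp add: mod_if)

lemma base_square_eq:
  assumes "i < n" "j < n" "2 < n"
  shows "base_square n i j =
    (let x = (if odd j \<and> i = 0 then j + 2 else if odd j \<and> i = 2 then j else i + j)
     in if x < n then x else x - n)"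
  using assms unfolding base_square_def Let_def by (subst mod_lt_twice) auto

text \<open>Since n is even, the odd columns of rows 0 and 2 carry the same set of symbols, the odd
  ones. Exchanging these two parts therefore leaves every row a permutation.\<close>

lemma base_square_inj_row:
  assumes "i < n" "j < n" "j' < n" "2 < n" "even n" "base_square n i j = base_square n i j'"
  shows "j = j'"
  using assms by (simp add: base_square_eq Let_def split: if_splits; presburger)

lemma base_square_inj_col:
  assumes "i < n" "i' < n" "j < n" "2 < n" "even n" "base_square n i j = base_square n i' j"
  shows "i = i'"
  using assms by (simp add: base_square_eq Let_def split: if_splits; presburger)

lemma flip_col_less: "even n \<Longrightarrow> n mod 4 = 2 \<Longrightarrow> 2 < n \<Longrightarrow> flip_col n + 1 < (n::nat)"
  unfolding flip_col_def by (auto; presburger)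

lemma even_flip_col [simp]: "even (flip_col n)"
  by (simp add: flip_col_def)

lemma swap_cols_swap: "swap_cols n (swap_cols n j) = j"
  by (auto simp: swap_cols_def)

text \<open>For even q, rows 1 and 2 contain q + 1 and q + 2 (modulo n) in columns q and q + 1, in
  opposite order. Exchanging the two columns inside these rows is thus the same as exchanging the
  two rows inside these columns.\<close>

lemma base_square_swap_cols:
  assumes "i = 1 \<or> i = 2" "j = flip_col n \<or> j = flip_col n + 1"
  shows "base_square n i (swap_cols n j) = base_square n (3 - i) j"
  using assms even_flip_col[of n]
  by (auto simp: swap_cols_def base_square_def)

lemma latin_square_plex_square:
  assumes "even n" "2 < n"
  shows "latin_square n (plex_square n)"
proof -
  have lt: "plex_square n i j < n" for i j
    using assms by (simp add: plex_square_def base_square_def)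
  have swap_lt: "swap_cols n j < n" if "n mod 4 = 2" "j < n" for j
    using flip_col_less[OF assms(1) that(1) assms(2)] that by (auto simp: swap_cols_def)
  have row: "inj_on (\<lambda>j. plex_square n i j) {..<n}" if "i < n" for i
  proof (rule inj_onI)
    fix j j' assume j: "j \<in> {..<n}" "j' \<in> {..<n}" and eq: "plex_square n i j = plex_square n i j'"
    show "j = j'"
    proof (cases "n mod 4 = 2 \<and> (i = 1 \<or> i = 2)")
      case True
      then have "base_square n i (swap_cols n j) = base_square n i (swap_cols n j')"
        using eq by (simp add: plex_square_def)
      then have "swap_cols n j = swap_cols n j'"
        using base_square_inj_row[OF that] j swap_lt True assms by auto
      then show ?thesis by (metis swap_cols_swap)
    next
      case False
      then have "base_square n i j = base_square n i j'"
        using eq unfolding plex_square_def by presburger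
      then show ?thesis
        using base_square_inj_row[OF that] j assms by auto
    qed
  qed
  have col: "inj_on (\<lambda>i. plex_square n i j) {..<n}" if "j < n" for j
  proof (rule inj_onI)
    fix i i' assume i: "i \<in> {..<n}" "i' \<in> {..<n}" and eq: "plex_square n i j = plex_square n i' j"
    \<comment> \<open>In the two switched columns \<open>p\<close> exchanges rows 1 and 2, so each
      column of the new square is a column of the base square composed with an involution.\<close>
    define p where "p = (\<lambda>i. if n mod 4 = 2 \<and> (i = 1 \<or> i = 2) \<and> (j = flip_col n \<or> j = flip_col n + 1)
      then 3 - i else (i::nat))"
    have pp: "p (p i) = i" for i by (auto simp: p_def)
    have p_lt: "p i < n" if "i < n" for i using that assms by (auto simp: p_def)
    have sq: "plex_square n i j = base_square n (p i) j" for i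
      using base_square_swap_cols[of i j n] by (auto simp: plex_square_def p_def swap_cols_def)
    have "p i = p i'"
      using base_square_inj_col[of "p i" n "p i'" j] p_lt i that assms eq sq by auto
    then show "i = i'" by (metis pp)
  qed
  show ?thesis
    unfolding latin_square_def
    using lt card_fibre_inj[OF row] card_fibre_inj[OF col] by (simp del: One_nat_def)
qed

section \<open>The range of odd plexes\<close>

lemma
  fixes g :: "nat \<Rightarrow> int"
  assumes "is_kplex n L k P"
  shows sum_kplex_rows: "(\<Sum>c\<in>P. g (fst c)) = int k * (\<Sum>i<n. g i)"
    and sum_kplex_cols: "(\<Sum>c\<in>P. g (snd c)) = int k * (\<Sum>i<n. g i)"
    and sum_kplex_symbols: "(\<And>i j. i < n \<Longrightarrow> j < n \<Longrightarrow> L i j < n) \<Longrightarrow>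
      (\<Sum>c\<in>P. g (L (fst c) (snd c))) = int k * (\<Sum>i<n. g i)"
proof -
  have P: "P \<subseteq> {0..<n} \<times> {0..<n}"
    using assms by (simp add: is_kplex_def)
  then have fin: "finite P" by (rule finite_subset) simp
  \<comment> \<open>Group the cells of \<open>P\<close> by the value of \<open>\<phi>\<close>; every
    fibre has k elements.\<close>
  have *: "(\<Sum>c\<in>P. g (\<phi> c)) = int k * (\<Sum>i<n. g i)"
    if "\<phi> ` P \<subseteq> {..<n}" "\<And>i. i < n \<Longrightarrow> card {c \<in> P. \<phi> c = i} = k" for \<phi>
  proof -
    have "(\<Sum>c\<in>P. g (\<phi> c)) = (\<Sum>i<n. \<Sum>c | c \<in> P \<and> \<phi> c = i. g (\<phi> c))"
      using sum.group[OF fin _ that(1), of "\<lambda>c. g (\<phi> c)"] by simp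
    also have "\<dots> = (\<Sum>i<n. int k * g i)"
      using that(2) by (intro sum.cong) auto
    finally show ?thesis by (simp add: sum_distrib_left)
  qed
  have "card {c \<in> P. fst c = i} = k" if "i < n" for i
  proof -
    have "{c \<in> P. fst c = i} = Pair i ` {j. (i, j) \<in> P}" by force
    then show ?thesis
      using assms that by (simp add: is_kplex_def card_image inj_on_def)
  qed
  then show "(\<Sum>c\<in>P. g (fst c)) = int k * (\<Sum>i<n. g i)"
    using P by (intro *) auto
  have "card {c \<in> P. snd c = j} = k" if "j < n" for j
  proof -
    have "{c \<in> P. snd c = j} = (\<lambda>i. (i, j)) ` {i. (i, j) \<in> P}" by force
    then show ?thesis
      using assms that by (simp add: is_kplex_def card_image inj_on_def)
  qed
  then show "(\<Sum>c\<in>P. g (snd c)) = int k * (\<Sum>i<n. g i)"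
    using P by (intro *) auto
  show "(\<Sum>c\<in>P. g (L (fst c) (snd c))) = int k * (\<Sum>i<n. g i)"
    if "\<And>i j. i < n \<Longrightarrow> j < n \<Longrightarrow> L i j < n"
    using P assms that by (intro *[of "\<lambda>c. L (fst c) (snd c)"]) (auto simp: is_kplex_def)
qed

text \<open>The small representative of symbol minus row minus column modulo \<open>n\<close>.\<close>

definition defect :: "nat \<Rightarrow> nat \<Rightarrow> nat \<Rightarrow> int" where
  "defect n i j =
     (let flip = (n mod 4 = 2 \<and> (j = flip_col n \<or> j = flip_col n + 1)) in
      if i = 0 then (if odd j then 2 else 0)
      else if i = 1 then (if flip then (if odd j then -1 else 1) else 0)
      else if i = 2 then (if flip then -1 else if odd j then -2 else 0)
      else 0)"

lemma plex_square_cong_defect: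
  "int n dvd int (plex_square n i j) - int i - int j - defect n i j"
proof -
  have eq: "int n dvd int (x mod n) - y" if "int x = y" for x y
    by (simp add: that[symmetric] zmod_int mod_eq_dvd_iff flip: mod_eq_dvd_iff)
  show ?thesis
    using even_flip_col[of n]
    unfolding plex_square_def base_square_def defect_def swap_cols_def Let_def diff_diff_eq
    by (intro eq) auto
qed

lemma kplex_ge:
  assumes n: "even n" "2 < n" and P: "is_kplex n (plex_square n) k P" and "odd k"
  shows "n div 4 \<le> k"
proof -
  define h where "h = n div 2"
  have nh: "int n = 2 * int h" using n(1) by (auto simp: h_def)
  have "P \<subseteq> {0..<n} \<times> {0..<n}"
    using P by (simp add: is_kplex_def)
  then have fin: "finite P" by (rule finite_subset) simp
  define S where "S = (\<Sum>c\<in>P. defect n (fst c) (snd c))"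
  define W where "W = (\<Sum>i<n. int i)"
  have lt: "plex_square n i j < n" for i j
    using n by (simp add: plex_square_def base_square_def)
  have "int n dvd (\<Sum>c\<in>P. int (plex_square n (fst c) (snd c)) - int (fst c) - int (snd c)
      - defect n (fst c) (snd c))"
    by (intro dvd_sum plex_square_cong_defect)
  also have "\<dots> = - (int k * W) - S"
    using sum_kplex_rows[OF P, of int] sum_kplex_cols[OF P, of int]
      sum_kplex_symbols[OF P lt, of int]
    by (simp add: sum_subtractf S_def W_def)
  finally have dvd: "int n dvd int k * W + S"
    by (metis dvd_minus_iff minus_add_distrib uminus_add_conv_diff add.commute)
  have "2 * W = int n * (int n - 1)"
    unfolding W_def by (induction n) (auto simp: algebra_simps)
  then have W: "W = int h * (int n - 1)" by (simp add: nh)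
  \<comment> \<open>Both k and n - 1 are odd, so k W is an odd multiple of h, congruent to h modulo
    n = 2h. Hence S is an odd multiple of h as well.\<close>
  obtain w where w: "int k * (int n - 1) = 2 * w + 1"
    using \<open>odd k\<close> n by (metis even_add even_diff even_mult_iff even_of_nat oddE odd_one)
  have "int k * W + S = int h * (int k * (int n - 1)) + S" by (simp add: W)
  also have "\<dots> = int n * w + (int h + S)" unfolding w by (simp add: nh algebra_simps)
  finally have "int n dvd int h + S" using dvd by (metis dvd_add_right_iff dvd_triv_left)
  then obtain t where "int h + S = int n * t" by auto
  then have St: "S = (2 * t - 1) * int h" by (simp add: nh algebra_simps)
  have "2 * t - 1 \<noteq> 0" by presburger
  then have "\<bar>2 * t - 1\<bar> \<ge> 1" by linarith
  then have absS: "int h \<le> \<bar>S\<bar>"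
    by (simp add: St abs_mult mult_le_cancel_right1)
  \<comment> \<open>The switched intercalate has one cell of defect 1 and one of defect -1 in row 1;
    \<open>e\<close> bounds the contribution of each.\<close>
  define e where "e = (if n mod 4 = 2 then 1 else 0 :: int)"
  define q where "q = flip_col n"
  have rowsum: "(\<Sum>c\<in>P. if fst c = r then 2 else 0) = 2 * int k" if "r < n" for r
    using sum_kplex_rows[OF P, of "\<lambda>i. if i = r then 2 else 0"] that by simp
  have cell: "(\<Sum>c\<in>P. if c = z then e else 0) \<le> e" for z
    using fin by (auto simp: e_def)
  \<comment> \<open>Positive defects occur only in row 0 and at \<open>(1, q)\<close>, negative ones
    only in row 2 and at \<open>(1, q + 1)\<close>.\<close>
  have "S \<le> (\<Sum>c\<in>P. (if fst c = 0 then 2 else 0) + (if c = (1, q) then e else 0))"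
    unfolding S_def
    by (intro sum_mono) (auto simp: defect_def e_def q_def Let_def prod_eq_iff)
  also have "\<dots> \<le> 2 * int k + e"
    using cell rowsum[of 0] n by (simp add: sum.distrib)
  finally have 1: "S \<le> 2 * int k + e" .
  have "- S \<le> (\<Sum>c\<in>P. (if fst c = 2 then 2 else 0) + (if c = (1, q + 1) then e else 0))"
    unfolding S_def sum_negf[symmetric]
    by (intro sum_mono) (auto simp: defect_def e_def q_def Let_def prod_eq_iff)
  also have "\<dots> \<le> 2 * int k + e"
    using cell rowsum[of 2] n by (simp add: sum.distrib)
  finally have "int h \<le> 2 * int k + e" using 1 absS by linarith
  then show ?thesis
    using n unfolding e_def h_def by (auto split: if_splits; presburger)
qed

section \<open>Complements of plexes\<close>

lemma is_kplex_complement: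
  assumes L: "latin_square n L" and P: "is_kplex n L k P"
  shows "is_kplex n L (n - k) ({0..<n} \<times> {0..<n} - P)"
proof -
  have sub: "P \<subseteq> {0..<n} \<times> {0..<n}" and cardP: "card P = k * n"
    using P by (auto simp: is_kplex_def)
  have fin: "finite P" using sub finite_subset by blast
  have row: "card {j. (i, j) \<in> {0..<n} \<times> {0..<n} - P} = n - k" if "i < n" for i
  proof -
    have "{j. (i, j) \<in> {0..<n} \<times> {0..<n} - P} = {0..<n} - {j. (i, j) \<in> P}"
      using that by auto
    moreover have "{j. (i, j) \<in> P} \<subseteq> {0..<n}" using sub by auto
    ultimately show ?thesis
      using P that by (simp add: card_Diff_subset finite_subset is_kplex_def)
  qed
  have col: "card {i. (i, j) \<in> {0..<n} \<times> {0..<n} - P} = n - k" if "j < n" for j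
  proof -
    have "{i. (i, j) \<in> {0..<n} \<times> {0..<n} - P} = {0..<n} - {i. (i, j) \<in> P}"
      using that by auto
    moreover have "{i. (i, j) \<in> P} \<subseteq> {0..<n}" using sub by auto
    ultimately show ?thesis
      using P that by (simp add: card_Diff_subset finite_subset is_kplex_def)
  qed
  have sym: "card {c \<in> {0..<n} \<times> {0..<n} - P. L (fst c) (snd c) = s} = n - k" if "s < n" for s
  proof -
    let ?A = "{c \<in> {0..<n} \<times> {0..<n}. L (fst c) (snd c) = s}"
    have "?A = (SIGMA i:{0..<n}. {j. j < n \<and> L i j = s})" by auto
    also have "card \<dots> = n"
      using L that by (subst card_SigmaI) (auto simp: latin_square_def)
    finally have "card ?A = n" .
    moreover have "{c \<in> {0..<n} \<times> {0..<n} - P. L (fst c) (snd c) = s}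
        = ?A - {c \<in> P. L (fst c) (snd c) = s}" by auto
    moreover have "{c \<in> P. L (fst c) (snd c) = s} \<subseteq> ?A" using sub by auto
    ultimately show ?thesis
      using P that fin by (simp add: card_Diff_subset is_kplex_def)
  qed
  show ?thesis
    unfolding is_kplex_def
    using row col sym sub fin cardP
    by (auto simp: card_Diff_subset diff_mult_distrib2 mult.commute)
qed

lemma kplex_le:
  assumes "is_kplex n L k P" "0 < n"
  shows "k \<le> n"
proof -
  have "{j. (0, j) \<in> P} \<subseteq> {0..<n}" "card {j. (0, j) \<in> P} = k"
    using assms by (auto simp: is_kplex_def)
  then show ?thesis by (metis card_atLeastLessThan card_mono diff_zero finite_atLeastLessThan)
qed

section \<open>Plexes from periodic test functions\<close>

lemma sum_period:
  fixes G :: "int \<Rightarrow> int"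
  assumes per: "\<And>x. G (x + n) = G x" and "0 \<le> n"
  shows "(\<Sum>x=a..<a+n. G x) = (\<Sum>x=0..<n. G x)"
proof (cases "n = 0")
  case False
  then have n: "0 < n" using assms by simp
  have step: "(\<Sum>x=a+1..<a+1+n. G x) = (\<Sum>x=a..<a+n. G x)" for a
  proof -
    have "{a..<a+n} = insert a {a+1..<a+n}" "{a+1..<a+1+n} = insert (a+n) {a+1..<a+n}"
      using n by auto
    then show ?thesis using per[of a] by simp
  qed
  show ?thesis
  proof (induction a rule: int_induct[of _ 0])
    case (step1 i)
    then show ?case using step[of i] by simp
  next
    case (step2 i)
    then show ?case using step[of "i - 1"] by simp
  qed simp
qed simp

lemma sum_shift_int: "(\<Sum>x=a..<b. G (x + u)) = (\<Sum>x=a+u..<b+u. G x)" for a b u :: int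
  by (rule sum.reindex_bij_witness[of _ "\<lambda>x. x - u" "\<lambda>x. x + u"]) auto

lemma sum_period_shift:
  fixes G :: "int \<Rightarrow> int"
  assumes "\<And>x. G (x + n) = G x" "0 \<le> n"
  shows "(\<Sum>x=a..<a+n. G (x + u)) = (\<Sum>x=0..<n. G x)"
  using sum_period[of G n "a + u"] assms by (simp add: sum_shift_int algebra_simps)

lemma sum_even_odd:
  fixes G :: "int \<Rightarrow> int"
  shows "(\<Sum>x=0..<int h. G (2 * x) + G (2 * x + 1)) = (\<Sum>x=0..<2 * int h. G x)"
proof (induction h)
  case (Suc h)
  have "{0..<int (Suc h)} = insert (int h) {0..<int h}"
    "{0..<2 * int (Suc h)} = insert (2 * int h) (insert (2 * int h + 1) {0..<2 * int h})"
    by auto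
  then show ?case using Suc by simp
qed simp

text \<open>As x runs through h consecutive integers, 2x + u meets each residue modulo 2h of the
  parity of u exactly once, and u and w have opposite parities.\<close>

lemma sum_half_period:
  fixes G :: "int \<Rightarrow> int"
  assumes per: "\<And>x. G (x + 2 * int h) = G x" and "odd (u + w)"
  shows "(\<Sum>x=a..<a+int h. G (2 * x + u)) + (\<Sum>x=b..<b+int h. G (2 * x + w))
    = (\<Sum>x=0..<2 * int h. G x)"
proof -
  have H: "(\<Sum>x=a..<a+int h. G (2 * x + (2 * v + e))) = (\<Sum>x=0..<int h. G (2 * x + e))" for a v e
  proof -
    have "(\<Sum>x=a..<a+int h. G (2 * (x + v) + e)) = (\<Sum>x=0..<int h. G (2 * x + e))"
      using per[of "2 * _ + e"]
      by (intro sum_period_shift[of "\<lambda>x. G (2 * x + e)"]) (simp_all add: algebra_simps)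
    then show ?thesis by (simp add: algebra_simps)
  qed
  have *: "(\<Sum>x=a..<a+int h. G (2 * x + u)) + (\<Sum>x=b..<b+int h. G (2 * x + w))
    = (\<Sum>x=0..<2 * int h. G x)" if "even u" "odd w" for a b u w
  proof -
    obtain v v' where "u = 2 * v + 0" "w = 2 * v' + 1"
      using \<open>even u\<close> \<open>odd w\<close> by (metis add_0_right evenE oddE)
    then show ?thesis
      using H[where a = a and v = v and e = 0] H[where a = b and v = v' and e = 1] sum_even_odd[of G h] by (simp add: sum.distrib)
  qed
  show ?thesis
  proof (cases "even u")
    case True
    then show ?thesis using * assms(2) by simp
  next
    case False
    then show ?thesis using *[of w u b a] assms(2) by (simp add: add.commute)
  qed
qed

text \<open>In the addition table the diagonal of shift u has the symbol 2x + u in row x. Two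
  diagonals whose shifts have opposite parities therefore contain every symbol twice: they form a
  2-plex.\<close>

lemma sum_double_period:
  fixes G :: "int \<Rightarrow> int"
  assumes per: "\<And>x. G (x + 2 * int h) = G x" and "odd (u + w)"
  shows "(\<Sum>x=a..<a+2*int h. G (2 * x + u) + G (2 * x + w)) = 2 * (\<Sum>x=0..<2 * int h. G x)"
proof -
  have split: "(\<Sum>x=a..<a+2*int h. F x) = (\<Sum>x=a..<a+int h. F x) + (\<Sum>x=a+int h..<a+int h+int h. F x)"
    for F :: "int \<Rightarrow> int"
    by (subst sum.union_disjoint[symmetric]) (auto intro!: sum.cong)
  show ?thesis
    unfolding sum.distrib split
    using sum_half_period[of G h u w a a, OF per] assms(2)
      sum_half_period[of G h u w "a + int h" "a + int h", OF per] by linarith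
qed

text \<open>A plex given by its columns \<open>f r t\<close> in row \<open>r\<close>. Testing against periodic functions \<open>G\<close> instead of
  single columns and symbols turns the counts into sums that telescope.\<close>

lemma kplex_of_family:
  fixes f sy :: "int \<Rightarrow> 'a \<Rightarrow> int"
  assumes n: "0 < n" and I: "finite I" "card I = k"
    and inj: "\<And>r. a \<le> r \<Longrightarrow> r < a + int n \<Longrightarrow> inj_on (\<lambda>t. f r t mod int n) I"
    and sy: "\<And>r t. a \<le> r \<Longrightarrow> r < a + int n \<Longrightarrow> t \<in> I \<Longrightarrow>
      int (L (nat (r mod int n)) (nat (f r t mod int n))) = sy r t mod int n"
    and cols: "\<And>G::int \<Rightarrow> int. (\<And>x. G (x + int n) = G x) \<Longrightarrow>
      (\<Sum>r=a..<a+int n. \<Sum>t\<in>I. G (f r t)) = int k * (\<Sum>x=0..<int n. G x)"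
    and symbols: "\<And>G::int \<Rightarrow> int. (\<And>x. G (x + int n) = G x) \<Longrightarrow>
      (\<Sum>r=a..<a+int n. \<Sum>t\<in>I. G (sy r t)) = int k * (\<Sum>x=0..<int n. G x)"
  shows "has_kplex n L k"
proof -
  define R where "R = {a..<a + int n}"
  define \<phi> where "\<phi> = (\<lambda>(r, t). (nat (r mod int n), nat (f r t mod int n)))"
  define P where "P = \<phi> ` (R \<times> I)"
  have label: "\<exists>!r. r \<in> R \<and> nat (r mod int n) = i" if "i < n" for i
  proof
    let ?r = "a + (int i - a) mod int n"
    have "?r mod int n = int i mod int n" by (simp add: mod_simps)
    then have "nat (?r mod int n) = i" using that by simp
    then show "?r \<in> R \<and> nat (?r mod int n) = i" using n by (simp add: R_def)
    fix r assume r: "r \<in> R \<and> nat (r mod int n) = i"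
    then have "r mod int n = int i" using n by auto
    then have "(int i - a) mod int n = (r - a) mod int n" by (metis mod_diff_left_eq)
    then show "r = ?r" using r by (simp add: R_def)
  qed
  have inj_label: "r = r'" if "r \<in> R" "r' \<in> R" "nat (r mod int n) = nat (r' mod int n)" for r r'
    using label[of "nat (r mod int n)"] that n by (metis nat_less_iff of_nat_0_less_iff pos_mod_bound pos_mod_sign)
  have \<phi>inj: "inj_on \<phi> (R \<times> I)"
  proof (rule inj_onI)
    fix z z' assume z: "z \<in> R \<times> I" "z' \<in> R \<times> I" "\<phi> z = \<phi> z'"
    obtain r t r' t' where [simp]: "z = (r, t)" "z' = (r', t')" by fastforce
    have "r = r'" using z inj_label by (auto simp: \<phi>_def)
    moreover have "t = t'"
      using z inj[of r] \<open>r = r'\<close> n by (auto simp: \<phi>_def R_def eq_nat_nat_iff dest: inj_onD)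
    ultimately show "z = z'" by simp
  qed
  have count: "card {z \<in> R \<times> I. w (fst z) (snd z) mod int n = int s} = k"
    if "s < n" and w: "\<And>G::int \<Rightarrow> int. (\<And>x. G (x + int n) = G x) \<Longrightarrow>
      (\<Sum>r=a..<a+int n. \<Sum>t\<in>I. G (w r t)) = int k * (\<Sum>x=0..<int n. G x)" for w s
  proof -
    \<comment> \<open>The indicator of a residue class is periodic and has sum 1 over a period; as a
      test function it turns the sum identity into a cell count.\<close>
    define G :: "int \<Rightarrow> int" where "G = (\<lambda>x. of_bool (x mod int n = int s))"
    have "int (card {z \<in> R \<times> I. w (fst z) (snd z) mod int n = int s})
        = (\<Sum>z\<in>R \<times> I. G (w (fst z) (snd z)))"
      using I by (simp add: G_def R_def Collect_conj_eq Int_commute flip: sum.inter_filter)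
    also have "\<dots> = (\<Sum>r=a..<a+int n. \<Sum>t\<in>I. G (w r t))"
      by (simp add: sum.cartesian_product R_def case_prod_beta)
    also have "\<dots> = int k * (\<Sum>x=0..<int n. G x)"
      by (rule w) (simp add: G_def)
    also have "(\<Sum>x=0..<int n. G x) = (\<Sum>x=0..<int n. if x = int s then 1 else 0)"
      by (intro sum.cong) (auto simp: G_def)
    also have "\<dots> = 1" using that by simp
    finally show ?thesis by simp
  qed
  have image_count: "card {c \<in> P. Q c} = k"
    if "card {z \<in> R \<times> I. w (fst z) (snd z) mod int n = int s} = k"
      "\<And>r t. r \<in> R \<Longrightarrow> t \<in> I \<Longrightarrow> Q (\<phi> (r, t)) \<longleftrightarrow> w r t mod int n = int s" for Q w s
  proof -
    have "{c \<in> P. Q c} = \<phi> ` {z \<in> R \<times> I. w (fst z) (snd z) mod int n = int s}"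
      using that(2) by (force simp: P_def)
    then show ?thesis
      using that(1) \<phi>inj by (simp add: card_image inj_on_subset)
  qed
  have "P \<subseteq> {0..<n} \<times> {0..<n}"
    using n by (auto simp: P_def \<phi>_def nat_less_iff)
  moreover have "card P = k * n"
    using card_image[OF \<phi>inj] I by (simp add: P_def R_def card_cartesian_product)
  moreover have "card {j. (i, j) \<in> P} = k" if "i < n" for i
  proof -
    obtain r where r: "r \<in> R" "nat (r mod int n) = i" using label \<open>i < n\<close> by blast
    have "{j. (i, j) \<in> P} = (\<lambda>t. nat (f r t mod int n)) ` I"
      using r inj_label by (force simp: P_def \<phi>_def)
    moreover have "inj_on (\<lambda>t. nat (f r t mod int n)) I"
      using inj[of r] r n by (auto simp: inj_on_def R_def eq_nat_nat_iff)
    ultimately show ?thesis using I by (simp add: card_image)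
  qed
  moreover have "card {i. (i, j) \<in> P} = k" if "j < n" for j
  proof -
    have "{c \<in> P. snd c = j} = (\<lambda>i. (i, j)) ` {i. (i, j) \<in> P}" by force
    then have "card {i. (i, j) \<in> P} = card {c \<in> P. snd c = j}"
      by (simp add: card_image inj_on_def)
    also have "\<dots> = k"
      using n by (intro image_count[OF count[OF that cols]]) (auto simp: \<phi>_def nat_eq_iff)
    finally show ?thesis .
  qed
  moreover have "card {c \<in> P. L (fst c) (snd c) = s} = k" if "s < n" for s
  proof (intro image_count[OF count[OF that symbols]])
    fix r t assume "r \<in> R" "t \<in> I"
    then show "L (fst (\<phi> (r, t))) (snd (\<phi> (r, t))) = s \<longleftrightarrow> sy r t mod int n = int s"
      using sy[of r t] by (simp add: \<phi>_def R_def) (metis of_nat_eq_iff)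
  qed
  ultimately show ?thesis unfolding has_kplex_def is_kplex_def by blast
qed

section \<open>The cells of the plexes\<close>

text \<open>The cells of a plex in a fixed row are indexed by tags: \<open>TB\<close> and \<open>TA\<close> stand for the diagonals with
  odd and with even shift whose cells in rows 0 and 2 are rearranged, \<open>TQ\<close> for the near
  transversal, and \<open>TY\<close> and \<open>TX\<close> for further diagonals with odd and with even shift.
  \<open>offset\<close> is the column minus the row; \<open>z\<close> is the label of row 0, \<open>a\<close> is the first row in which
  the near transversal has an odd shift, and \<open>oc\<close>, \<open>ec\<close> tell whether the row lies on the chain of
  rows in which a cell of the last \<open>TB\<close> diagonal, or of the near transversal, is moved two
  columns to the left.\<close>

datatype tag = TB nat | TA nat | TQ | TX nat | TY nat

definition tags :: "nat \<Rightarrow> nat \<Rightarrow> tag set" where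
  "tags T E = TB ` {..<T} \<union> TA ` {..<T} \<union> {TQ} \<union> TX ` {..<E} \<union> TY ` {..<E}"

lemma mem_tags [simp]:
  "TB s \<in> tags T E \<longleftrightarrow> s < T" "TA s \<in> tags T E \<longleftrightarrow> s < T" "TQ \<in> tags T E"
  "TX e \<in> tags T E \<longleftrightarrow> e < E" "TY e \<in> tags T E \<longleftrightarrow> e < E"
  by (auto simp: tags_def)

fun offset :: "int \<Rightarrow> nat \<Rightarrow> int \<Rightarrow> int \<Rightarrow> bool \<Rightarrow> bool \<Rightarrow> int \<Rightarrow> tag \<Rightarrow> int" where
  "offset \<tau> T z a oc ec r (TB s) = (if r = 2 then - 8 + 4 * \<tau> - 4 * int s
     else - 1 - 4 * int s - (if Suc s = T \<and> oc then 2 else 0))"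
| "offset \<tau> T z a oc ec r (TA s) = (if r = z then 1 - 4 * int s else - 6 + 4 * \<tau> - 4 * int s)"
| "offset \<tau> T z a oc ec r TQ = (if r < a then 4 - (if ec then 2 else 0) else 3 - (if r = a then 2 else 0))"
| "offset \<tau> T z a oc ec r (TX e) = (if \<tau> = 1 then 6 + 2 * int e else if e = 0 then - 4 else 4 + 2 * int e)"
| "offset \<tau> T z a oc ec r (TY e) = 7 + 2 * int e + (if r = z then 2 else if r = 2 then - 2 else 0)"

section \<open>Distinct columns for the cells of one row\<close>

lemma even_offset:
  "r \<noteq> 2 \<Longrightarrow> even (offset \<tau> T z a oc ec r (TB s)) = False"
  "r \<noteq> z \<Longrightarrow> even (offset \<tau> T z a oc ec r (TA s)) = True"
  "even (offset \<tau> T z a oc ec r TQ) = (r < a)"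
  "even (offset \<tau> T z a oc ec r (TX e)) = True"
  "even (offset \<tau> T z a oc ec r (TY e)) = False"
  by auto

text \<open>The final disjuncts are the four values of g. Excluding the differences 0 and
  \<open>N\<close> is enough: two offsets differ by less than 2N, as shown in
  \<open>cells_inj\<close>, and \<open>t\<close> and \<open>t'\<close> may be interchanged.\<close>

lemma offset_inj_row0:
  assumes "t \<in> tags T E" "t' \<in> tags T E"
    and "offset \<tau> T z a oc ec z t - offset \<tau> T z a oc ec z t' \<in> {0, N}"
    and "\<not> oc" "z \<noteq> 2"
    and "(\<tau> = 0 \<and> z = 0 \<and> 1 \<le> T \<and> E < T \<and> N = 8 * int T \<and> 0 < a) \<or>
      (\<tau> = 0 \<and> z = 0 \<and> 2 \<le> T \<and> E \<le> T \<and> E + 3 \<le> 2 * T \<and> N = 8 * int T + 2 \<and> 0 < a) \<or>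
      (\<tau> = 1 \<and> E \<le> T \<and> N = 8 * int T + 4 \<and> a < z) \<or>
      (\<tau> = 1 \<and> E \<le> T + 1 \<and> E \<le> 2 * T \<and> N = 8 * int T + 6 \<and> a < z)"
  shows "t = t'"
  using assms(6)
proof (elim disjE)
  assume "\<tau> = 0 \<and> z = 0 \<and> 1 \<le> T \<and> E < T \<and> N = 8 * int T \<and> 0 < a"
  with assms(1-5) show ?thesis
    by - (cases t; cases t'; simp split: if_splits; presburger)
next
  assume "\<tau> = 0 \<and> z = 0 \<and> 2 \<le> T \<and> E \<le> T \<and> E + 3 \<le> 2 * T \<and> N = 8 * int T + 2 \<and> 0 < a"
  with assms(1-5) show ?thesis
    by - (cases t; cases t'; simp split: if_splits; presburger)
next
  assume "\<tau> = 1 \<and> E \<le> T \<and> N = 8 * int T + 4 \<and> a < z"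
  with assms(1-5) show ?thesis
    by - (cases t; cases t'; simp split: if_splits; presburger)
next
  assume "\<tau> = 1 \<and> E \<le> T + 1 \<and> E \<le> 2 * T \<and> N = 8 * int T + 6 \<and> a < z"
  with assms(1-5) show ?thesis
    by - (cases t; cases t'; simp split: if_splits; presburger)
qed

text \<open>The first two disjuncts both belong to g = 0. For T = 2 row 2 lies on the even chain,
  and this keeps \<open>TQ\<close> apart from \<open>TB 1\<close>: unmoved, its offset 4 would agree
  with -12 modulo 16.\<close>

lemma offset_inj_row2:
  assumes "t \<in> tags T E" "t' \<in> tags T E"
    and "offset \<tau> T z a oc ec 2 t - offset \<tau> T z a oc ec 2 t' \<in> {0, N}"
    and "\<not> oc" "z \<noteq> 2" "2 < a"
    and "(\<tau> = 0 \<and> 1 \<le> T \<and> E < T \<and> N = 8 * int T \<and> \<not> ec \<and> T \<noteq> 2) \<or>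
      (\<tau> = 0 \<and> 2 \<le> T \<and> E < T \<and> N = 8 * int T \<and> ec) \<or>
      (\<tau> = 0 \<and> 2 \<le> T \<and> E \<le> T \<and> E + 3 \<le> 2 * T \<and> N = 8 * int T + 2) \<or>
      (\<tau> = 1 \<and> E \<le> T \<and> N = 8 * int T + 4) \<or>
      (\<tau> = 1 \<and> E \<le> T + 1 \<and> E \<le> 2 * T \<and> N = 8 * int T + 6)"
  shows "t = t'"
  using assms(7)
proof (elim disjE)
  assume "\<tau> = 0 \<and> 1 \<le> T \<and> E < T \<and> N = 8 * int T \<and> \<not> ec \<and> T \<noteq> 2"
  with assms(1-6) show ?thesis
    by - (cases t; cases t'; simp split: if_splits; presburger)
next
  assume "\<tau> = 0 \<and> 2 \<le> T \<and> E < T \<and> N = 8 * int T \<and> ec"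
  with assms(1-6) show ?thesis
    by - (cases t; cases t'; simp split: if_splits; presburger)
next
  assume "\<tau> = 0 \<and> 2 \<le> T \<and> E \<le> T \<and> E + 3 \<le> 2 * T \<and> N = 8 * int T + 2"
  with assms(1-6) show ?thesis
    by - (cases t; cases t'; simp split: if_splits; presburger)
next
  assume "\<tau> = 1 \<and> E \<le> T \<and> N = 8 * int T + 4"
  with assms(1-6) show ?thesis
    by - (cases t; cases t'; simp split: if_splits; presburger)
next
  assume "\<tau> = 1 \<and> E \<le> T + 1 \<and> E \<le> 2 * T \<and> N = 8 * int T + 6"
  with assms(1-6) show ?thesis
    by - (cases t; cases t'; simp split: if_splits; presburger)
qed

text \<open>\<open>N\<close> is even, so only offsets of equal parity can collide. Once the pairs of
  opposite parity are discarded, linear arithmetic settles the rest.\<close>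

lemma offset_inj_other:
  assumes "t \<in> tags T E" "t' \<in> tags T E"
    and "offset \<tau> T z a oc ec r t - offset \<tau> T z a oc ec r t' \<in> {0, N}"
    and "r \<noteq> z" "r \<noteq> 2"
    and "(\<tau> = 0 \<and> E < T \<and> N = 8 * int T \<and> 2 \<le> T) \<or>
      (\<tau> = 0 \<and> T = 1 \<and> E = 0 \<and> N = 8 \<and> \<not> ec) \<or>
      (\<tau> = 0 \<and> 2 \<le> T \<and> E \<le> T \<and> E + 3 \<le> 2 * T \<and> N = 8 * int T + 2) \<or>
      (\<tau> = 1 \<and> E \<le> T \<and> N = 8 * int T + 4) \<or>
      (\<tau> = 1 \<and> E \<le> T + 1 \<and> E \<le> 2 * T \<and> N = 8 * int T + 6)"
  shows "t = t'"
proof -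
  have "even N" using assms(6) by auto
  then have par: "even (offset \<tau> T z a oc ec r t) = even (offset \<tau> T z a oc ec r t')"
    using assms(3) by (metis diff_add_cancel even_add insertE even_zero singletonD)
  show ?thesis using assms(6)
  proof (elim disjE)
    assume "\<tau> = 0 \<and> E < T \<and> N = 8 * int T \<and> 2 \<le> T"
    with assms(1-5) par show ?thesis
      by - (cases "r < a"; cases t; cases t'; simp only: even_offset simp_thms; simp split: if_splits; linarith)
  next
    assume "\<tau> = 0 \<and> T = 1 \<and> E = 0 \<and> N = 8 \<and> \<not> ec"
    with assms(1-5) par show ?thesis
      by - (cases "r < a"; cases t; cases t'; simp only: even_offset simp_thms; simp split: if_splits; linarith)
  next
    assume "\<tau> = 0 \<and> 2 \<le> T \<and> E \<le> T \<and> E + 3 \<le> 2 * T \<and> N = 8 * int T + 2"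
    with assms(1-5) par show ?thesis
      by - (cases "r < a"; cases t; cases t'; simp only: even_offset simp_thms; simp split: if_splits; linarith)
  next
    assume "\<tau> = 1 \<and> E \<le> T \<and> N = 8 * int T + 4"
    with assms(1-5) par show ?thesis
      by - (cases "r < a"; cases t; cases t'; simp only: even_offset simp_thms; simp split: if_splits; linarith)
  next
    assume "\<tau> = 1 \<and> E \<le> T + 1 \<and> E \<le> 2 * T \<and> N = 8 * int T + 6"
    with assms(1-5) par show ?thesis
      by - (cases "r < a"; cases t; cases t'; simp only: even_offset simp_thms; simp split: if_splits; linarith)
  qed
qed

text \<open>Row labels are the integers in \<open>{g - 1..<g - 1 + n}\<close>, so that the near transversal does not wrap
  around; therefore row 0 has the label \<open>n\<close> if \<open>g \<ge> 2\<close>. The excluded parameters are the pairs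
  \<open>(n, k)\<close> equal to (6, 3), (10, 3), (10, 5) and (18, 9), for which two of the chosen
  diagonals would meet.\<close>

locale plex_family =
  fixes T g E :: nat
  assumes g: "g < 4"
    and T_pos: "g < 2 \<Longrightarrow> 1 \<le> T"
    and E_le: "2 * E < 2 * T + g"
    and not_special: "(T, g, E) \<notin> {(0, 3, 1), (1, 1, 0), (1, 1, 1), (2, 1, 2)}"
begin

definition n :: nat where "n = 8 * T + 2 * g"
definition \<tau> :: int where "\<tau> = (if g < 2 then 0 else 1)"
text \<open>Counted from the first label g - 1, \<open>4 T + 2 \<tau>\<close> rows precede
  \<open>a\<close>: half of all rows if g is even, one fewer if g is odd.\<close>

definition a :: int where "a = 4 * int T + int g - 1 + 2 * \<tau>"
definition row0 :: int where "row0 = (if g < 2 then 0 else int n)"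

text \<open>The bounds make the moved columns telescope. In total the odd chain gains column g + 2
  and loses column \<open>2 T + g + 2 \<tau>\<close>; the even chain gains the latter and loses
  \<open>a + 1\<close>.\<close>

definition odd_chain :: "int \<Rightarrow> bool" where
  "odd_chain r \<longleftrightarrow> 4 * int T + int g + 1 \<le> r \<and> r < 6 * int T + int g - 1 + 2 * \<tau> \<and> odd (r - int g)"
definition even_chain :: "int \<Rightarrow> bool" where
  "even_chain r \<longleftrightarrow> 2 * int T + int g - 2 + 2 * \<tau> \<le> r \<and> r < 4 * int T + int g - 2 + 2 * \<tau> \<and> even (r - int g)"

definition off :: "int \<Rightarrow> tag \<Rightarrow> int" where
  "off r t = offset \<tau> T row0 a (odd_chain r) (even_chain r) r t"

text \<open>In each case the parameters become linear expressions in T, so that later side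
  conditions reduce to linear arithmetic. The excluded triples sharpen the bounds for g = 1 and g =
  3.\<close>

lemma regimes:
  obtains
    (0) "int g = 0" "\<tau> = 0" "int n = 8 * int T" "row0 = 0" "a = 4 * int T - 1" "1 \<le> T" "E < T"
  | (1) "int g = 1" "\<tau> = 0" "int n = 8 * int T + 2" "row0 = 0" "a = 4 * int T" "2 \<le> T" "E \<le> T" "E + 3 \<le> 2 * T"
  | (2) "int g = 2" "\<tau> = 1" "int n = 8 * int T + 4" "row0 = int n" "a = 4 * int T + 3" "E \<le> T"
  | (3) "int g = 3" "\<tau> = 1" "int n = 8 * int T + 6" "row0 = int n" "a = 4 * int T + 4" "E \<le> T + 1" "E \<le> 2 * T"
proof -
  consider "g = 0" | "g = 1" | "g = 2" | "g = 3" using g by linarith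
  then show ?thesis
  proof cases
    case 1
    have "\<tau> = 0" "int n = 8 * int T" "row0 = 0" "a = 4 * int T - 1"
      unfolding n_def \<tau>_def a_def row0_def by (simp_all add: 1)
    moreover have "int g = 0" "1 \<le> T" "E < T" using 1 T_pos E_le by simp_all
    ultimately show ?thesis using that(1) by blast
  next
    case 2
    have "\<tau> = 0" "int n = 8 * int T + 2" "row0 = 0" "a = 4 * int T"
      unfolding n_def \<tau>_def a_def row0_def by (simp_all add: 2)
    moreover have "int g = 1" "2 \<le> T" "E \<le> T" "E + 3 \<le> 2 * T" using 2 T_pos E_le not_special by auto
    ultimately show ?thesis using that(2) by blast
  next
    case 3
    have "\<tau> = 1" "int n = 8 * int T + 4" "row0 = int n" "a = 4 * int T + 3"
      unfolding n_def \<tau>_def a_def row0_def by (simp_all add: 3)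
    moreover have "int g = 2" "E \<le> T" using 3 E_le by simp_all
    ultimately show ?thesis using that(3) by blast
  next
    case 4
    have "\<tau> = 1" "int n = 8 * int T + 6" "row0 = int n" "a = 4 * int T + 4"
      unfolding n_def \<tau>_def a_def row0_def by (simp_all add: 4)
    moreover have "int g = 3" "E \<le> T + 1" "E \<le> 2 * T" using 4 E_le not_special by auto
    ultimately show ?thesis using that(4) by blast
  qed
qed

lemma special_rows:
  "2 < a" "row0 \<noteq> 2" "row0 \<noteq> a" "\<tau> = 0 \<or> \<tau> = 1" "\<tau> = 0 \<Longrightarrow> row0 < a" "\<tau> = 1 \<Longrightarrow> a < row0"
  "int g - 1 \<le> row0" "row0 < int g - 1 + int n" "int g - 1 \<le> a" "a < int g - 1 + int n"
  "int g \<le> 3" "4 \<le> n"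
  by (rule regimes, linarith+)+

lemma not_odd_chain: "\<not> odd_chain row0" "\<not> odd_chain 2"
proof -
  have "row0 < 4 * int T + int g + 1 \<or> 6 * int T + int g - 1 + 2 * \<tau> \<le> row0"
    "2 < 4 * int T + int g + 1"
    by (rule regimes, linarith+)+
  then show "\<not> odd_chain row0" "\<not> odd_chain 2"
    by (auto simp: odd_chain_def)
qed

end

lemma offset_bounds:
  assumes t: "t \<in> tags T E" and \<tau>: "\<tau> = 0 \<and> 0 < T \<or> \<tau> = 1"
  shows "(if T = 0 then 1 else - 4 * int T - 4) \<le> offset \<tau> T z a oc ec r t"
    and "offset \<tau> T z a oc ec r t \<le> (if E = 0 then 4 else 2 * int E + 7)"
proof -
  consider (B) s where "t = TB s" "s < T" | (A) s where "t = TA s" "s < T" | (Q) "t = TQ"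
    | (X) e where "t = TX e" "e < E" | (Y) e where "t = TY e" "e < E"
    using t by (cases t) auto
  then have "(if T = 0 then 1 else - 4 * int T - 4) \<le> offset \<tau> T z a oc ec r t \<and>
    offset \<tau> T z a oc ec r t \<le> (if E = 0 then 4 else 2 * int E + 7)"
    by cases (use \<tau> in auto)
  then show "(if T = 0 then 1 else - 4 * int T - 4) \<le> offset \<tau> T z a oc ec r t"
    "offset \<tau> T z a oc ec r t \<le> (if E = 0 then 4 else 2 * int E + 7)" by auto
qed

context plex_family
begin

lemma off_inj:
  assumes t: "t \<in> tags T E" "t' \<in> tags T E" and r: "int g - 1 \<le> r" "r < int g - 1 + int n"
    and D: "off r t - off r t' \<in> {0, int n}"
  shows "t = t'"
proof -
  consider "r = row0" | "r = 2" | "r \<noteq> row0" "r \<noteq> 2" by blast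
  then show ?thesis
  proof cases
    case 1
    have "(\<tau> = 0 \<and> row0 = 0 \<and> 1 \<le> T \<and> E < T \<and> int n = 8 * int T \<and> 0 < a) \<or>
      (\<tau> = 0 \<and> row0 = 0 \<and> 2 \<le> T \<and> E \<le> T \<and> E + 3 \<le> 2 * T \<and> int n = 8 * int T + 2 \<and> 0 < a) \<or>
      (\<tau> = 1 \<and> E \<le> T \<and> int n = 8 * int T + 4 \<and> a < row0) \<or>
      (\<tau> = 1 \<and> E \<le> T + 1 \<and> E \<le> 2 * T \<and> int n = 8 * int T + 6 \<and> a < row0)"
    proof (rule regimes)
      assume *: "\<tau> = 0" "row0 = 0" "int n = 8 * int T" "1 \<le> T" "E < T"
      moreover have "0 < a" using special_rows(1) by simp
      ultimately show ?thesis by blast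
    next
      assume *: "\<tau> = 0" "row0 = 0" "int n = 8 * int T + 2" "2 \<le> T" "E \<le> T" "E + 3 \<le> 2 * T"
      moreover have "0 < a" using special_rows(1) by simp
      ultimately show ?thesis by blast
    qed (use special_rows(6) in blast)+
    from offset_inj_row0[OF t _ _ _ this] show ?thesis
      using D special_rows(2) not_odd_chain(1) unfolding off_def 1 by blast
  next
    case 2
    have "even_chain 2 \<longleftrightarrow> T = 2" if "int g = 0" "\<tau> = 0"
      using that unfolding even_chain_def by auto
    note chain2 = this
    have "(\<tau> = 0 \<and> 1 \<le> T \<and> E < T \<and> int n = 8 * int T \<and> \<not> even_chain 2 \<and> T \<noteq> 2) \<or>
      (\<tau> = 0 \<and> 2 \<le> T \<and> E < T \<and> int n = 8 * int T \<and> even_chain 2) \<or>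
      (\<tau> = 0 \<and> 2 \<le> T \<and> E \<le> T \<and> E + 3 \<le> 2 * T \<and> int n = 8 * int T + 2) \<or>
      (\<tau> = 1 \<and> E \<le> T \<and> int n = 8 * int T + 4) \<or>
      (\<tau> = 1 \<and> E \<le> T + 1 \<and> E \<le> 2 * T \<and> int n = 8 * int T + 6)"
    proof (rule regimes)
      assume *: "int g = 0" "\<tau> = 0" "int n = 8 * int T" "1 \<le> T" "E < T"
      show ?thesis
      proof (cases "T = 2")
        case True
        then have "2 \<le> T" "even_chain 2" using * chain2 by simp_all
        then show ?thesis using * by blast
      next
        case False
        then have "\<not> even_chain 2" using * chain2 by simp
        then show ?thesis using False * by blast
      qed
    qed blast+
    from offset_inj_row2[OF t _ _ _ _ this] show ?thesis
      using D special_rows(1,2) not_odd_chain(2) unfolding off_def 2 by blast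
  next
    case 3
    \<comment> \<open>Here the even chain is row 0 alone. In any other row a moved \<open>TQ\<close>
      would have offset 2, which agrees with the offset -6 of \<open>TA 0\<close> modulo 8.\<close>
    have "\<not> even_chain r" if "int g = 0" "\<tau> = 0" "row0 = 0" "T = 1"
    proof
      assume "even_chain r"
      then have "0 \<le> r" "r < 2" "even r" using that unfolding even_chain_def by auto
      then have "r = 0" by presburger
      then show False using 3 that by simp
    qed
    note no_chain = this
    have "(\<tau> = 0 \<and> E < T \<and> int n = 8 * int T \<and> 2 \<le> T) \<or>
      (\<tau> = 0 \<and> T = 1 \<and> E = 0 \<and> int n = 8 \<and> \<not> even_chain r) \<or>
      (\<tau> = 0 \<and> 2 \<le> T \<and> E \<le> T \<and> E + 3 \<le> 2 * T \<and> int n = 8 * int T + 2) \<or>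
      (\<tau> = 1 \<and> E \<le> T \<and> int n = 8 * int T + 4) \<or>
      (\<tau> = 1 \<and> E \<le> T + 1 \<and> E \<le> 2 * T \<and> int n = 8 * int T + 6)"
    proof (rule regimes)
      assume *: "int g = 0" "\<tau> = 0" "int n = 8 * int T" "row0 = 0" "1 \<le> T" "E < T"
      show ?thesis
      proof (cases "T = 1")
        case True
        then have "int n = 8" "E = 0" "\<not> even_chain r" using * no_chain by simp_all
        then show ?thesis using True * by blast
      next
        case False
        then have "2 \<le> T" using * by linarith
        then show ?thesis using * by blast
      qed
    qed blast+
    from offset_inj_other[OF t _ _ _ this] show ?thesis
      using D 3 unfolding off_def by blast
  qed
qed

lemma cells_inj:
  assumes r: "int g - 1 \<le> r" "r < int g - 1 + int n"
  shows "inj_on (\<lambda>t. (r + off r t) mod int n) (tags T E)"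
proof (rule inj_onI)
  fix t t' assume t: "t \<in> tags T E" "t' \<in> tags T E"
    and eq: "(r + off r t) mod int n = (r + off r t') mod int n"
  then have "int n dvd off r t - off r t'" by (simp add: mod_eq_dvd_iff)
  then obtain z where z: "off r t - off r t' = int n * z" by blast
  \<comment> \<open>A congruence modulo n thus leaves only the differences -n, 0 and n; the first
    reduces to the last by interchanging the two tags.\<close>
  have lt: "off r t - off r t' < 2 * int n" if "t \<in> tags T E" "t' \<in> tags T E" for t t'
  proof -
    have "(if E = 0 then 4 else 2 * int E + 7) - (if T = 0 then 1 else - 4 * int T - 4) < 2 * int n"
      by (rule regimes) (auto split: if_split)
    moreover have "\<tau> = 0 \<and> 0 < T \<or> \<tau> = 1"
      by (rule regimes) linarith+
    ultimately show ?thesis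
      using offset_bounds(1)[OF that(2)] offset_bounds(2)[OF that(1)]
      unfolding off_def by (meson diff_mono le_less_trans)
  qed
  have "int n * z < int n * 2" "int n * (-2) < int n * z"
    using lt[of t t'] lt[of t' t] t z by linarith+
  moreover have "0 < int n" using special_rows(12) by linarith
  ultimately have "z < 2" "-2 < z" by (simp_all only: mult_less_cancel_left_pos)
  then have "z = -1 \<or> z = 0 \<or> z = 1" by linarith
  then show "t = t'"
    using off_inj[OF t r] off_inj[OF t(2,1) r] z by (auto simp: algebra_simps)
qed

section \<open>Symbols of the chosen cells\<close>

definition row1 :: int where "row1 = (if int g = 3 then int n + 1 else 1)"

text \<open>Labels start at g - 1, which lies between -1 and 2, so reduction modulo n needs at most
  one shift by n. For g = 3 they start at 2, which is why row 1 has the label n + 1.\<close>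

lemma row_labels:
  assumes r: "int g - 1 \<le> r" "r < int g - 1 + int n"
  shows "r mod int n = 0 \<longleftrightarrow> r = row0" "r mod int n = 1 \<longleftrightarrow> r = row1" "r mod int n = 2 \<longleftrightarrow> r = 2"
proof -
  have mod: "r mod int n = (if r < 0 then r + int n else if r < int n then r else r - int n)"
  proof -
    have "r < 2 * int n" "- int n \<le> r" using r special_rows(11,12) by linarith+
    then show ?thesis
      using mod_pos_pos_trivial[of "r + int n" "int n"] mod_pos_pos_trivial[of "r - int n" "int n"]
      by (simp split: if_split)
  qed
  have row0: "(row0 = 0 \<and> int g \<le> 1) \<or> (row0 = int n \<and> 2 \<le> int g)"
    by (rule regimes) linarith+
  have n: "4 \<le> int n" "int g \<le> 3" using special_rows(11,12) by linarith+
  show "r mod int n = 0 \<longleftrightarrow> r = row0"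
    unfolding mod using r n row0 by (auto split: if_splits)
  show "r mod int n = 1 \<longleftrightarrow> r = row1"
    unfolding mod row1_def using r n by (auto split: if_splits)
  show "r mod int n = 2 \<longleftrightarrow> r = 2"
    unfolding mod using r n by (auto split: if_splits)
qed

text \<open>In row 0 all cells except \<open>TX\<close>, and \<open>TQ\<close> if
  \<open>\<tau> = 0\<close>, lie in odd columns; in row 2 only the \<open>TY\<close> cells do. The
  \<open>TY\<close> terms of the two rows cancel, and the total is 4T + g = h.\<close>

definition defect_of :: "int \<Rightarrow> tag \<Rightarrow> int" where
  "defect_of r t =
     (if r = row0 then (case t of TX e \<Rightarrow> 0 | TQ \<Rightarrow> 2 * \<tau> | _ \<Rightarrow> 2)
      else if r = 2 then (case t of TY e \<Rightarrow> - 2 | _ \<Rightarrow> 0)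
      else if r = row1 \<and> (int g = 1 \<and> t = TB 0 \<or> int g = 3 \<and> t = TQ) then 1
      else 0)"

lemma dvd_small_iff: "\<bar>v\<bar> < int n \<Longrightarrow> int n dvd v \<longleftrightarrow> v = 0"
  using dvd_imp_le_int[of v "int n"] by auto

text \<open>Of the four cells of the switched intercalate the plex uses exactly one, in row 1 and
  column \<open>q\<close>, with defect 1. The offsets are small enough compared with n that
  divisibility means equality to 0 or to a known multiple of n.\<close>

lemma flip_cells:
  assumes t: "t \<in> tags T E" and g13: "int g = 1 \<or> int g = 3"
  defines "q \<equiv> (if int g = 1 then 0 else 4)"
  shows "int n dvd row1 + off row1 t - q \<longleftrightarrow> int g = 1 \<and> t = TB 0 \<or> int g = 3 \<and> t = TQ"
    and "\<not> int n dvd row1 + off row1 t - (q + 1)"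
    and "\<not> int n dvd 2 + off 2 t - q"
    and "\<not> int n dvd 2 + off 2 t - (q + 1)"
proof -
  consider (B) s where "t = TB s" "s < T" | (A) s where "t = TA s" "s < T" | (Q) "t = TQ"
    | (X) e where "t = TX e" "e < E" | (Y) e where "t = TY e" "e < E"
    using t by (cases t) auto
  note tags_cases = this
  have chain2: "\<not> even_chain 2" using g13 unfolding even_chain_def by auto
  have "(int n dvd row1 + off row1 t - q \<longleftrightarrow> int g = 1 \<and> t = TB 0 \<or> int g = 3 \<and> t = TQ) \<and>
    \<not> int n dvd row1 + off row1 t - (q + 1) \<and> \<not> int n dvd 2 + off 2 t - q \<and> \<not> int n dvd 2 + off 2 t - (q + 1)"
    using g13
  proof
    assume g1: "int g = 1"
    have q: "q = 0" and row1: "row1 = 1" unfolding q_def row1_def by (simp_all add: g1)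
    have vals: "\<tau> = 0" "int n = 8 * int T + 2" "row0 = 0" "a = 4 * int T" "2 \<le> T" "E \<le> T"
      using g1 by (rule_tac regimes; linarith)+
    have chain1: "\<not> even_chain 1" "\<not> odd_chain 1"
      using vals g1 unfolding even_chain_def odd_chain_def by linarith+
    note small = dvd_small_iff[unfolded vals(2)]
    show ?thesis
      using tags_cases unfolding q row1 vals(2) off_def
      by cases (use vals chain1 chain2 not_odd_chain(2) in \<open>simp add: small g1\<close>)+
  next
    assume g3: "int g = 3"
    have q: "q = 4" and row1: "row1 = int n + 1" unfolding q_def row1_def by (simp_all add: g3)
    have vals: "\<tau> = 1" "int n = 8 * int T + 6" "row0 = int n" "a = 4 * int T + 4" "E \<le> T + 1" "E \<le> 2 * T"
      using g3 by (rule_tac regimes; linarith)+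
    have chain1: "\<not> odd_chain (int n + 1)"
      using vals g3 unfolding odd_chain_def by linarith
    have shift: "int n dvd row1 + x - y \<longleftrightarrow> int n dvd 1 + x - y" for x y
      using dvd_add_right_iff[of "int n" "int n" "1 + x - y"] by (simp add: row1 algebra_simps)
    note small = dvd_small_iff[unfolded vals(2)]
    show ?thesis
      using tags_cases unfolding shift unfolding q row1 off_def vals(2)
      by cases (use vals chain1[unfolded vals(2)] chain2 not_odd_chain(2) in \<open>simp add: small g3\<close>)+
  qed
  then show "int n dvd row1 + off row1 t - q \<longleftrightarrow> int g = 1 \<and> t = TB 0 \<or> int g = 3 \<and> t = TQ"
    "\<not> int n dvd row1 + off row1 t - (q + 1)" "\<not> int n dvd 2 + off 2 t - q"
    "\<not> int n dvd 2 + off 2 t - (q + 1)" by blast+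
qed

lemma parity_row0:
  "t \<in> tags T E \<Longrightarrow> (if odd (row0 + off row0 t) then 2 else 0) = defect_of row0 t"
proof -
  have "even row0" by (rule regimes) (auto)
  moreover have "\<tau> = 0 \<and> row0 < a \<or> \<tau> = 1 \<and> a < row0" using special_rows(4-6) by blast
  ultimately show ?thesis
    using special_rows(2,3) not_odd_chain(1) by (cases t) (auto simp: off_def defect_of_def)
qed

lemma parity_row2:
  "t \<in> tags T E \<Longrightarrow> (if odd (2 + off 2 t) then - 2 else 0) = defect_of 2 t"
  using special_rows(1,2) not_odd_chain(2) by (cases t) (auto simp: off_def defect_of_def)

text \<open>By \<open>plex_square_cong_defect\<close> only the defect must be identified. Since n is
  even, column parities survive reduction modulo n and decide rows 0 and 2;
  \<open>flip_cells\<close> covers the switched cells.\<close>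

lemma cell_symbol:
  assumes r: "int g - 1 \<le> r" "r < int g - 1 + int n" and t: "t \<in> tags T E"
  shows "int (plex_square n (nat (r mod int n)) (nat ((r + off r t) mod int n)))
    = (r + (r + off r t) + defect_of r t) mod int n"
proof -
  define i where "i = nat (r mod int n)"
  define j where "j = nat ((r + off r t) mod int n)"
  have n: "4 \<le> n" "even n" using special_rows(12) by (simp_all add: n_def)
  have i: "int i = r mod int n" and j: "int j = (r + off r t) mod int n"
    using n by (simp_all add: i_def j_def)
  have rows: "i = 0 \<longleftrightarrow> r = row0" "i = 1 \<longleftrightarrow> r = row1" "i = 2 \<longleftrightarrow> r = 2"
    using row_labels[OF r] unfolding i[symmetric] by simp_all
  have odd_j: "odd j \<longleftrightarrow> odd (r + off r t)"
    unfolding even_of_nat[symmetric, where 'a = int] j using n by (simp add: dvd_mod_iff)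
  have defect: "defect n i j = defect_of r t"
  proof (cases "i = 1 \<or> i = 2")
    case False
    then show ?thesis
      using rows odd_j parity_row0[OF t] unfolding defect_def Let_def
      by (auto simp: defect_of_def)
  next
    case True
    have g4: "n mod 4 = 2 \<longleftrightarrow> int g = 1 \<or> int g = 3"
      using special_rows(11) unfolding n_def by presburger
    show ?thesis
    proof (cases "int g = 1 \<or> int g = 3")
      case False
      then have "\<not> n mod 4 = 2" using g4 by simp
      then have "defect n i j = (if i = 2 \<and> odd j then - 2 else 0)"
        using True by (auto simp: defect_def)
      then show ?thesis
        using rows odd_j parity_row2[OF t] False True unfolding defect_of_def by auto
    next
      case g13: True
      define q where "q = (if int g = 1 then 0 else 4 :: int)"
      have "n mod 8 = 2 \<longleftrightarrow> int g = 1" using g13 unfolding n_def by presburger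
      then have q: "int (flip_col n) = q" by (simp add: flip_col_def q_def)
      have q_less: "q + 1 < int n" "0 \<le> q"
        using flip_col_less[of n] n g13 g4 q by auto
      have col: "j = m \<longleftrightarrow> int n dvd r + off r t - int m" if "m < n" for m
        unfolding mod_eq_dvd_iff[symmetric] using j that by (metis mod_less of_nat_eq_iff zmod_int)
      have flip: "j = flip_col n \<longleftrightarrow> int n dvd r + off r t - q"
        "j = flip_col n + 1 \<longleftrightarrow> int n dvd r + off r t - (q + 1)"
        using col[of "flip_col n"] col[of "flip_col n + 1"] q_less q by (simp_all add: algebra_simps)
      note cells = flip_cells[OF t g13, folded q_def]
      have [simp]: "n mod 4 = 2" using g13 g4 by simp
      from True show ?thesis
      proof
        assume "i = 1"
        then have "r = row1" "r \<noteq> row0" "r \<noteq> 2" using rows by auto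
        then show ?thesis
          using cells(1,2) flip \<open>i = 1\<close> even_flip_col[of n]
          by (auto simp: defect_def defect_of_def Let_def)
      next
        assume "i = 2"
        then have "r = 2" using rows by simp
        then have "defect n i j = (if odd j then - 2 else 0)"
          using cells(3,4) flip \<open>i = 2\<close> by (auto simp: defect_def Let_def)
        then show ?thesis
          using parity_row2[OF t] odd_j \<open>r = 2\<close> by simp
      qed
    qed
  qed
  have "int n dvd int (plex_square n i j) - (r + (r + off r t) + defect_of r t)"
  proof -
    have "(int i + int j + defect_of r t) mod int n = (r + (r + off r t) + defect_of r t) mod int n"
      unfolding i j by (intro mod_add_cong) simp_all
    then have "int n dvd (int i + int j + defect_of r t) - (r + (r + off r t) + defect_of r t)"
      by (simp only: mod_eq_dvd_iff)
    from dvd_add[OF plex_square_cong_defect[of n i j, unfolded defect] this]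
    show ?thesis by (simp add: algebra_simps)
  qed
  moreover have "plex_square n i j < n" using n by (simp add: plex_square_def base_square_def)
  ultimately show ?thesis
    unfolding i_def[symmetric] j_def[symmetric] mod_eq_dvd_iff[symmetric] by simp
qed

end

section \<open>Column and symbol counts\<close>

lemma sum_tags:
  "(\<Sum>t\<in>tags T E. F t :: int) =
    (\<Sum>s<T. F (TB s)) + (\<Sum>s<T. F (TA s)) + F TQ + (\<Sum>e<E. F (TX e)) + (\<Sum>e<E. F (TY e))"
  unfolding tags_def
  by (subst sum.union_disjoint, simp, simp, force)+ (simp add: sum.reindex inj_on_def)

lemma card_tags: "card (tags T E) = 2 * T + 1 + 2 * E"
proof -
  have "int (card (tags T E)) = (\<Sum>t\<in>tags T E. 1)" by simp
  also have "\<dots> = int (2 * T + 1 + 2 * E)" by (subst sum_tags) simp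
  finally show ?thesis by linarith
qed

lemma sum_telescope_steps:
  fixes G :: "int \<Rightarrow> int"
  shows "(\<Sum>s<m. G (x + 2 * int s) - G (x + 2 + 2 * int s)) = G x - G (x + 2 * int m)"
  by (induction m) (simp_all add: algebra_simps)

context plex_family
begin

definition row_range :: "int set" where "row_range = {int g - 1..<int g - 1 + int n}"
text \<open>For \<open>\<tau> = 0\<close> the chain lowers only T - 1 of the T raised odd symbols;
  the last one is compensated in row \<open>a\<close>, where the near transversal has shift 1
  instead of 3.\<close>

definition odd_chain_length :: nat where "odd_chain_length = (if g < 2 then T - 1 else T)"

lemma odd_chain_length_eq: "int odd_chain_length = int T - 1 + \<tau>"
  using T_pos unfolding odd_chain_length_def \<tau>_def by auto

lemma sum_odd_chain:
  "(\<Sum>r\<in>row_range. if odd_chain r then F r else 0) = (\<Sum>s<odd_chain_length. F (4 * int T + int g + 1 + 2 * int s))"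
  for F :: "int \<Rightarrow> int"
proof -
  have "(\<Sum>r\<in>row_range. if odd_chain r then F r else 0) = (\<Sum>r\<in>{r \<in> row_range. odd_chain r}. F r)"
    by (simp add: row_range_def flip: sum.inter_filter)
  also have "\<dots> = (\<Sum>s<odd_chain_length. F (4 * int T + int g + 1 + 2 * int s))"
  proof (rule sum.reindex_bij_witness[of _ "\<lambda>s. 4 * int T + int g + 1 + 2 * int s"
        "\<lambda>r. nat ((r - (4 * int T + int g + 1)) div 2)"])
    fix r assume r: "r \<in> {r \<in> row_range. odd_chain r}"
    then have "even (r - (4 * int T + int g + 1))" by (simp add: odd_chain_def)
    then obtain u where u: "r = 4 * int T + int g + 1 + 2 * u"
      by (metis add.commute diff_add_cancel evenE)
    have "0 \<le> u" "u < int odd_chain_length" using r unfolding u odd_chain_length_eq odd_chain_def by auto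
    then show "4 * int T + int g + 1 + 2 * int (nat ((r - (4 * int T + int g + 1)) div 2)) = r"
      "F (4 * int T + int g + 1 + 2 * int (nat ((r - (4 * int T + int g + 1)) div 2))) = F r"
      "nat ((r - (4 * int T + int g + 1)) div 2) \<in> {..<odd_chain_length}"
      unfolding u by auto
  next
    fix s assume "s \<in> {..<odd_chain_length}"
    then have s: "int s < int T - 1 + \<tau>" using odd_chain_length_eq by simp
    have "6 * int T + int g - 1 + 2 * \<tau> \<le> int g - 1 + int n"
      by (rule regimes) linarith+
    then show "4 * int T + int g + 1 + 2 * int s \<in> {r \<in> row_range. odd_chain r}"
      using s by (auto simp: odd_chain_def row_range_def)
  qed auto
  finally show ?thesis .
qed

lemma sum_even_chain:
  "(\<Sum>r\<in>row_range. if even_chain r then F r else 0) = (\<Sum>s<T. F (2 * int T + int g - 2 + 2 * \<tau> + 2 * int s))"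
  for F :: "int \<Rightarrow> int"
proof -
  have "(\<Sum>r\<in>row_range. if even_chain r then F r else 0) = (\<Sum>r\<in>{r \<in> row_range. even_chain r}. F r)"
    by (simp add: row_range_def flip: sum.inter_filter)
  also have "\<dots> = (\<Sum>s<T. F (2 * int T + int g - 2 + 2 * \<tau> + 2 * int s))"
  proof (rule sum.reindex_bij_witness[of _ "\<lambda>s. 2 * int T + int g - 2 + 2 * \<tau> + 2 * int s"
        "\<lambda>r. nat ((r - (2 * int T + int g - 2 + 2 * \<tau>)) div 2)"])
    fix r assume r: "r \<in> {r \<in> row_range. even_chain r}"
    then have "even (r - (2 * int T + int g - 2 + 2 * \<tau>))" by (simp add: even_chain_def)
    then obtain u where u: "r = 2 * int T + int g - 2 + 2 * \<tau> + 2 * u"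
      by (metis add.commute diff_add_cancel evenE)
    have "0 \<le> u" "u < int T" using r unfolding u even_chain_def by auto
    then show "2 * int T + int g - 2 + 2 * \<tau> + 2 * int (nat ((r - (2 * int T + int g - 2 + 2 * \<tau>)) div 2)) = r"
      "F (2 * int T + int g - 2 + 2 * \<tau> + 2 * int (nat ((r - (2 * int T + int g - 2 + 2 * \<tau>)) div 2))) = F r"
      "nat ((r - (2 * int T + int g - 2 + 2 * \<tau>)) div 2) \<in> {..<T}"
      unfolding u by auto
  next
    fix s assume s: "s \<in> {..<T}"
    have "int g - 1 \<le> 2 * int T + int g - 2 + 2 * \<tau>" "4 * int T + int g - 2 + 2 * \<tau> \<le> int g - 1 + int n"
      using s by (rule_tac [!] regimes) (simp; linarith)+
    then show "2 * int T + int g - 2 + 2 * \<tau> + 2 * int s \<in> {r \<in> row_range. even_chain r}"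
      using s by (auto simp: even_chain_def row_range_def)
  qed auto
  finally show ?thesis .
qed

definition x_off :: "nat \<Rightarrow> int" where
  "x_off e = (if \<tau> = 1 then 6 + 2 * int e else if e = 0 then - 4 else 4 + 2 * int e)"

text \<open>The first three lines on the right are what unmodified diagonals would contribute.\<close>

lemma row_sum:
  fixes G :: "int \<Rightarrow> int"
  shows "(\<Sum>t\<in>tags T E. G (u + off r t)) =
      (\<Sum>s<T. G (u - 1 - 4 * int s) + G (u - 6 + 4 * \<tau> - 4 * int s))
      + (if r < a then G (u + 4) else G (u + 3))
      + (\<Sum>e<E. G (u + x_off e) + G (u + 7 + 2 * int e))
      + (if r = row0 then (\<Sum>s<T. G (u + 1 - 4 * int s) - G (u - 6 + 4 * \<tau> - 4 * int s))
          + (\<Sum>e<E. G (u + 9 + 2 * int e) - G (u + 7 + 2 * int e)) else 0)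
      + (if r = 2 then (\<Sum>s<T. G (u - 8 + 4 * \<tau> - 4 * int s) - G (u - 1 - 4 * int s))
          + (\<Sum>e<E. G (u + 5 + 2 * int e) - G (u + 7 + 2 * int e)) else 0)
      + (if odd_chain r then G (u + 1 - 4 * int T) - G (u + 3 - 4 * int T) else 0)
      + (if even_chain r then G (u + 2) - G (u + 4) else 0)
      + (if r = a then G (u + 1) - G (u + 3) else 0)"
proof -
  have Q: "G (u + off r TQ) = (if r < a then G (u + 4) else G (u + 3))
      + (if even_chain r then G (u + 2) - G (u + 4) else 0)
      + (if r = a then G (u + 1) - G (u + 3) else 0)"
    by (auto simp: off_def even_chain_def a_def)
  have X: "(\<Sum>e<E. G (u + off r (TX e))) = (\<Sum>e<E. G (u + x_off e))"
    by (simp add: off_def x_off_def)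
  have Y: "(\<Sum>e<E. G (u + off r (TY e))) = (\<Sum>e<E. G (u + 7 + 2 * int e))
      + (if r = row0 then (\<Sum>e<E. G (u + 9 + 2 * int e) - G (u + 7 + 2 * int e)) else 0)
      + (if r = 2 then (\<Sum>e<E. G (u + 5 + 2 * int e) - G (u + 7 + 2 * int e)) else 0)"
    using special_rows(2) by (auto simp: off_def sum_subtractf algebra_simps)
  have A: "(\<Sum>s<T. G (u + off r (TA s))) = (\<Sum>s<T. G (u - 6 + 4 * \<tau> - 4 * int s))
      + (if r = row0 then (\<Sum>s<T. G (u + 1 - 4 * int s) - G (u - 6 + 4 * \<tau> - 4 * int s)) else 0)"
    by (auto simp: off_def sum_subtractf algebra_simps)
  have B: "(\<Sum>s<T. G (u + off r (TB s))) = (\<Sum>s<T. G (u - 1 - 4 * int s))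
      + (if r = 2 then (\<Sum>s<T. G (u - 8 + 4 * \<tau> - 4 * int s) - G (u - 1 - 4 * int s)) else 0)
      + (if odd_chain r then G (u + 1 - 4 * int T) - G (u + 3 - 4 * int T) else 0)"
  proof (cases "odd_chain r")
    case False
    then show ?thesis by (auto simp: off_def sum_subtractf algebra_simps)
  next
    case True
    then have r: "r \<noteq> 2" using not_odd_chain(2) by blast
    have "0 < T" using True unfolding odd_chain_def by (rule_tac regimes) linarith+
    then have *: "(\<Sum>s<T. F s) = (\<Sum>s<T-1. F s) + F (T - 1)" for F :: "nat \<Rightarrow> int"
      by (metis Suc_pred' sum.lessThan_Suc)
    have "(\<Sum>s<T-1. G (u + off r (TB s))) = (\<Sum>s<T-1. G (u - 1 - 4 * int s))"
      using r by (intro sum.cong) (auto simp: off_def algebra_simps)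
    then show ?thesis
      using True r \<open>0 < T\<close> unfolding * by (simp add: off_def of_nat_diff algebra_simps)
  qed
  show ?thesis unfolding sum_tags Q X Y A B sum.distrib by simp
qed

end

text \<open>Rows 0 and 2 run through their symbols downwards, the chains upwards; after reversal the
  sums match term by term.\<close>

lemma sum_reverse_steps:
  "(\<Sum>s<m. F (c - 4 * int s)) = (\<Sum>s<m. F (c + 4 - 4 * int m + 4 * int s) :: int)"
proof -
  have "(\<Sum>s<m. F (c - 4 * int s)) = (\<Sum>s<m. F (c - 4 * int (m - Suc s)))"
    by (rule sum.nat_diff_reindex[symmetric])
  also have "\<dots> = (\<Sum>s<m. F (c + 4 - 4 * int m + 4 * int s))"
    by (intro sum.cong arg_cong[of _ _ F]) (auto simp: of_nat_diff)
  finally show ?thesis .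
qed

context plex_family
begin

text \<open>\<open>K = 1\<close> gives the columns of the cells, \<open>K = 2\<close> their symbols
  before the defect is added.\<close>

lemma row_sums:
  fixes G :: "int \<Rightarrow> int" and K :: int
  shows "(\<Sum>r\<in>row_range. \<Sum>t\<in>tags T E. G (K * r + off r t)) =
      (\<Sum>s<T. \<Sum>r\<in>row_range. G (K * r - 1 - 4 * int s) + G (K * r - 6 + 4 * \<tau> - 4 * int s))
      + (\<Sum>r\<in>row_range. if r < a then G (K * r + 4) else G (K * r + 3))
      + (\<Sum>e<E. \<Sum>r\<in>row_range. G (K * r + x_off e) + G (K * r + 7 + 2 * int e))
      + ((\<Sum>s<T. G (K * row0 + 1 - 4 * int s) - G (K * row0 - 6 + 4 * \<tau> - 4 * int s))
          + (\<Sum>e<E. G (K * row0 + 9 + 2 * int e) - G (K * row0 + 7 + 2 * int e)))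
      + ((\<Sum>s<T. G (K * 2 - 8 + 4 * \<tau> - 4 * int s) - G (K * 2 - 1 - 4 * int s))
          + (\<Sum>e<E. G (K * 2 + 5 + 2 * int e) - G (K * 2 + 7 + 2 * int e)))
      + (\<Sum>s<odd_chain_length. G (K * (4 * int T + int g + 1 + 2 * int s) + 1 - 4 * int T)
          - G (K * (4 * int T + int g + 1 + 2 * int s) + 3 - 4 * int T))
      + (\<Sum>s<T. G (K * (2 * int T + int g - 2 + 2 * \<tau> + 2 * int s) + 2)
          - G (K * (2 * int T + int g - 2 + 2 * \<tau> + 2 * int s) + 4))
      + (G (K * a + 1) - G (K * a + 3))"
proof -
  have fin: "finite row_range" by (simp add: row_range_def)
  have mem: "row0 \<in> row_range" "2 \<in> row_range" "a \<in> row_range"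
    using special_rows(7-12) by (auto simp: row_range_def)
  show ?thesis
    unfolding row_sum sum.distrib[of _ _ row_range] sum_odd_chain sum_even_chain sum.delta[OF fin]
      sum.swap[of _ _ row_range]
    using mem by (simp add: sum.distrib)
qed

section \<open>Column counts\<close>

lemma sum_row_range_shift:
  fixes G :: "int \<Rightarrow> int"
  assumes "\<And>x. G (x + int n) = G x"
  shows "(\<Sum>r\<in>row_range. G (r + u)) = (\<Sum>x=0..<int n. G x)"
  unfolding row_range_def using assms by (intro sum_period_shift) auto

lemma sum_row_range_double:
  fixes G :: "int \<Rightarrow> int"
  assumes per: "\<And>x. G (x + int n) = G x" and "odd (u + w)"
  shows "(\<Sum>r\<in>row_range. G (2 * r + u) + G (2 * r + w)) = 2 * (\<Sum>x=0..<int n. G x)"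
proof -
  have n: "int n = 2 * int (4 * T + g)" by (simp add: n_def)
  show ?thesis
    unfolding row_range_def n using per assms(2) by (intro sum_double_period) (simp_all add: n)
qed

lemma sum_row_range_split: "(\<Sum>r\<in>row_range. if r < a then F r else H r) =
    (\<Sum>r=int g - 1..<a. F r) + (\<Sum>r=a..<int g - 1 + int n. H r)" for F H :: "int \<Rightarrow> int"
proof -
  have "row_range = {int g - 1..<a} \<union> {a..<int g - 1 + int n}" using special_rows(9,10) by (auto simp: row_range_def)
  then show ?thesis by (simp add: sum.union_disjoint)
qed

text \<open>The changes in rows 0 and 2 cancel. The near transversal doubles column
  \<open>a + 3\<close> and misses g + 2; the move in row \<open>a\<close>, the even chain and the
  odd chain carry the surplus via \<open>a + 1\<close> and \<open>2 T + g + 2 \<tau>\<close> to g +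
  2.\<close>

lemma column_sum:
  fixes G :: "int \<Rightarrow> int"
  assumes per: "\<And>x. G (x + int n) = G x"
  shows "(\<Sum>r\<in>row_range. \<Sum>t\<in>tags T E. G (r + off r t)) = int (2 * T + 1 + 2 * E) * (\<Sum>x=0..<int n. G x)"
proof -
  define C where "C = (\<Sum>x=0..<int n. G x)"
  have shift: "(\<Sum>r\<in>row_range. G (r + u)) = C" for u unfolding C_def using per by (rule sum_row_range_shift)
  have body: "(\<Sum>s<T. \<Sum>r\<in>row_range. G (r - 1 - 4 * int s) + G (r - 6 + 4 * \<tau> - 4 * int s)) = 2 * int T * C"
    using shift[of "- 1 - 4 * int _"] shift[of "- 6 + 4 * \<tau> - 4 * int _"]
    by (simp add: sum.distrib algebra_simps)
  have extra: "(\<Sum>e<E. \<Sum>r\<in>row_range. G (r + x_off e) + G (r + 7 + 2 * int e)) = 2 * int E * C"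
    using shift[of "x_off _"] shift[of "7 + 2 * int _"] by (simp add: sum.distrib algebra_simps)
  \<comment> \<open>Shift 4 ends at column \<open>a + 3\<close>, where shift 3 begins.\<close>
  have Q: "(\<Sum>r\<in>row_range. if r < a then G (r + 4) else G (r + 3)) = C + G (a + 3) - G (int g + 2)"
  proof -
    have "(\<Sum>r\<in>row_range. if r < a then G (r + 4) else G (r + 3))
        = (\<Sum>x=int g + 3..<a + 4. G x) + (\<Sum>x=a + 3..<int g + 2 + int n. G x)"
      unfolding sum_row_range_split sum_shift_int by (simp add: algebra_simps)
    also have "{a + 3..<int g + 2 + int n} = insert (a + 3) {a + 4..<int g + 2 + int n}"
      using special_rows(10) by auto
    also have "(\<Sum>x\<in>insert (a + 3) {a + 4..<int g + 2 + int n}. G x)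
        = G (a + 3) + (\<Sum>x=a + 4..<int g + 2 + int n. G x)" by simp
    also have "(\<Sum>x=int g + 3..<a + 4. G x) + (G (a + 3) + (\<Sum>x=a + 4..<int g + 2 + int n. G x))
        = G (a + 3) + (\<Sum>x=int g + 3..<int g + 2 + int n. G x)"
    proof -
      have "{int g + 3..<int g + 2 + int n} = {int g + 3..<a + 4} \<union> {a + 4..<int g + 2 + int n}"
        using special_rows(9,10) by auto
      then show ?thesis by (simp add: sum.union_disjoint)
    qed
    also have "(\<Sum>x=int g + 3..<int g + 2 + int n. G x) = C - G (int g + 2)"
    proof -
      have "{int g + 2..<int g + 2 + int n} = insert (int g + 2) {int g + 3..<int g + 2 + int n}"
        using special_rows(12) by auto
      then show ?thesis
        using sum_period[of G "int n" "int g + 2"] per by (simp add: C_def)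
    qed
    finally show ?thesis by simp
  qed
  have zero: "G (row0 + u) = G u" for u
    using per[of u] by (rule_tac regimes) (simp_all add: add.commute)
  have row0: "(\<Sum>s<T. G (row0 + 1 - 4 * int s) - G (row0 - 6 + 4 * \<tau> - 4 * int s))
      = (\<Sum>s<T. G (1 - 4 * int s) - G (- 6 + 4 * \<tau> - 4 * int s))"
    "(\<Sum>e<E. G (row0 + 9 + 2 * int e) - G (row0 + 7 + 2 * int e))
      = (\<Sum>e<E. G (9 + 2 * int e) - G (7 + 2 * int e))"
    using zero[of "1 - 4 * int _"] zero[of "- 6 + 4 * \<tau> - 4 * int _"]
      zero[of "9 + 2 * int _"] zero[of "7 + 2 * int _"]
    by (simp_all add: algebra_simps)
  have odd: "(\<Sum>s<odd_chain_length. G (4 * int T + int g + 1 + 2 * int s + 1 - 4 * int T)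
        - G (4 * int T + int g + 1 + 2 * int s + 3 - 4 * int T))
      = G (int g + 2) - G (2 * int T + int g + 2 * \<tau>)"
    using sum_telescope_steps[of G "int g + 2" odd_chain_length] by (simp add: odd_chain_length_eq algebra_simps)
  have even: "(\<Sum>s<T. G (2 * int T + int g - 2 + 2 * \<tau> + 2 * int s + 2)
        - G (2 * int T + int g - 2 + 2 * \<tau> + 2 * int s + 4))
      = G (2 * int T + int g + 2 * \<tau>) - G (a + 1)"
    using sum_telescope_steps[of G "2 * int T + int g + 2 * \<tau>" T] by (simp add: a_def algebra_simps)
  show ?thesis
    using row_sums[of G 1] unfolding mult_1 body extra Q row0 odd even
    by (simp add: C_def sum_subtractf algebra_simps)
qed

section \<open>Symbol counts\<close>

lemma row1_row_range: "row1 \<in> row_range" "row1 \<noteq> row0" "row1 \<noteq> 2"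
proof -
  have "(int g \<le> 2 \<and> row1 = 1 \<and> row0 \<noteq> 1) \<or> (int g = 3 \<and> row1 = int n + 1 \<and> row0 = int n)"
  proof (cases "int g = 3")
    case True
    then have "row0 = int n" by (rule_tac regimes) linarith+
    then show ?thesis using True unfolding row1_def by simp
  next
    case False
    then have "row1 = 1" "int g \<le> 2" using special_rows(11) unfolding row1_def by simp_all
    moreover have "row0 \<noteq> 1" using special_rows(12) by (rule_tac regimes) linarith+
    ultimately show ?thesis by blast
  qed
  then show "row1 \<in> row_range" "row1 \<noteq> row0" "row1 \<noteq> 2"
    using special_rows(12) by (auto simp: row_range_def)
qed

lemma defect_sum:
  fixes G :: "int \<Rightarrow> int"
  assumes per: "\<And>x. G (x + int n) = G x"
  shows "(\<Sum>r\<in>row_range. \<Sum>t\<in>tags T E. G (2 * r + off r t + defect_of r t)) =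
      (\<Sum>r\<in>row_range. \<Sum>t\<in>tags T E. G (2 * r + off r t))
      + (\<Sum>s<T. G (3 - 4 * int s) - G (- 1 - 4 * int s)) + \<tau> * (G 5 - G 3)
      + (\<Sum>e<E. G (11 + 2 * int e) + G (7 + 2 * int e) - 2 * G (9 + 2 * int e))
      + (if int g = 1 then G 2 - G 1 else if int g = 3 then G 6 - G 5 else 0)"
proof -
  define H where "H r = (\<Sum>t\<in>tags T E. G (2 * r + off r t + defect_of r t) - G (2 * r + off r t))" for r
  have "(\<Sum>r\<in>row_range. \<Sum>t\<in>tags T E. G (2 * r + off r t + defect_of r t)) -
      (\<Sum>r\<in>row_range. \<Sum>t\<in>tags T E. G (2 * r + off r t)) = (\<Sum>r\<in>row_range. H r)"
    by (simp add: H_def sum_subtractf)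
  also have "\<dots> = (\<Sum>r\<in>{row0, 2, row1}. H r)"
  proof (rule sum.mono_neutral_right)
    show "\<forall>r\<in>row_range - {row0, 2, row1}. H r = 0"
      by (auto simp: H_def defect_of_def)
    show "{row0, 2, row1} \<subseteq> row_range"
      using special_rows(7-12) row1_row_range(1) by (auto simp: row_range_def)
  qed (simp add: row_range_def)
  also have "\<dots> = H row0 + H 2 + H row1"
    using row1_row_range(2,3) special_rows(2) by simp
  finally have split: "(\<Sum>r\<in>row_range. \<Sum>t\<in>tags T E. G (2 * r + off r t + defect_of r t)) =
      (\<Sum>r\<in>row_range. \<Sum>t\<in>tags T E. G (2 * r + off r t)) + (H row0 + H 2 + H row1)" by simp
  have zero: "G (2 * row0 + u) = G u" for u
    using per[of u] per[of "u + int n"] by (rule_tac regimes) (simp_all add: algebra_simps)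
  have \<tau>: "\<tau> = 0 \<and> row0 < a \<or> \<tau> = 1 \<and> a < row0" using special_rows(4-6) by blast
  \<comment> \<open>The defect 2 takes \<open>TB s\<close> from -1 - 4s to 1 - 4s and
    \<open>TA s\<close> from 1 - 4s to 3 - 4s, so the middle terms cancel.\<close>
  have "H row0 = (\<Sum>s<T. G (2 * row0 + (1 - 4 * int s)) - G (2 * row0 + (- 1 - 4 * int s)))
      + (\<Sum>s<T. G (2 * row0 + (3 - 4 * int s)) - G (2 * row0 + (1 - 4 * int s)))
      + \<tau> * (G (2 * row0 + 5) - G (2 * row0 + 3))
      + (\<Sum>e<E. G (2 * row0 + (11 + 2 * int e)) - G (2 * row0 + (9 + 2 * int e)))"
    using \<tau> special_rows(2) not_odd_chain(1)
    unfolding H_def sum_tags by (auto simp: off_def defect_of_def algebra_simps)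
  then have H0: "H row0 = (\<Sum>s<T. G (3 - 4 * int s) - G (- 1 - 4 * int s)) + \<tau> * (G 5 - G 3)
      + (\<Sum>e<E. G (11 + 2 * int e) - G (9 + 2 * int e))"
    unfolding zero by (simp add: sum_subtractf)
  have H2: "H 2 = (\<Sum>e<E. G (7 + 2 * int e) - G (9 + 2 * int e))"
    using special_rows(2) unfolding H_def sum_tags by (simp add: off_def defect_of_def)
  have H1: "H row1 = (if int g = 1 then G 2 - G 1 else if int g = 3 then G 6 - G 5 else 0)"
  proof (cases "int g = 1 \<or> int g = 3")
    case False
    then show ?thesis using row1_row_range(2,3) by (simp add: H_def defect_of_def)
  next
    case True
    define t where "t = (if int g = 1 then TB 0 else TQ)"
    have t: "t \<in> tags T E" using True unfolding t_def by (rule_tac regimes) simp_all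
    have "H row1 = (\<Sum>t'\<in>{t}. G (2 * row1 + off row1 t' + defect_of row1 t') - G (2 * row1 + off row1 t'))"
      unfolding H_def
    proof (rule sum.mono_neutral_right)
      show "\<forall>t'\<in>tags T E - {t}. G (2 * row1 + off row1 t' + defect_of row1 t') - G (2 * row1 + off row1 t') = 0"
        using True row1_row_range(2,3) by (auto simp: defect_of_def t_def)
    qed (use t in \<open>auto simp: tags_def\<close>)
    also have "\<dots> = G (2 * row1 + off row1 t + 1) - G (2 * row1 + off row1 t)"
      using True row1_row_range(2,3) by (auto simp: defect_of_def t_def)
    also have "\<dots> = (if int g = 1 then G 2 - G 1 else if int g = 3 then G 6 - G 5 else 0)"
      using True
    proof
      assume g1: "int g = 1"
      have "\<not> odd_chain 1" unfolding odd_chain_def by (simp add: g1)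
      then show ?thesis unfolding t_def row1_def by (simp add: g1 off_def)
    next
      assume g3: "int g = 3"
      have "a < int n" using g3 by (rule_tac regimes) linarith+
      then have "off (int n + 1) TQ = 3" by (simp add: off_def)
      moreover have "G (2 * int n + u) = G u" for u
        using per[of u] per[of "u + int n"] by (simp add: algebra_simps)
      ultimately show ?thesis unfolding t_def row1_def by (simp add: g3 algebra_simps)
    qed
    finally show ?thesis .
  qed
  show ?thesis
    unfolding split H0 H2 H1 by (simp add: sum_subtractf sum.distrib sum_distrib_left sum_negf)
qed

text \<open>Altogether rows 0 and 2 raise T odd symbols -1 - 4s and T even symbols
  \<open>- 6 + 4 \<tau> - 4 s\<close> by 2. The chains lower them again, apart from one odd symbol
  if \<open>\<tau> = 0\<close>.\<close>

lemma symbol_sum: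
  fixes G :: "int \<Rightarrow> int"
  assumes per: "\<And>x. G (x + int n) = G x"
  shows "(\<Sum>r\<in>row_range. \<Sum>t\<in>tags T E. G (2 * r + off r t + defect_of r t)) =
    int (2 * T + 1 + 2 * E) * (\<Sum>x=0..<int n. G x)"
proof -
  define C where "C = (\<Sum>x=0..<int n. G x)"
  define h where "h = 4 * T + g"
  have n: "int n = 2 * int h" by (simp add: n_def h_def)
  have double: "(\<Sum>r\<in>row_range. G (2 * r + u) + G (2 * r + w)) = 2 * C" if "odd (u + w)" for u w
    unfolding C_def using per that by (rule sum_row_range_double)
  have minus: "G (u + int n) = G u" "G (int n + u) = G u" for u
    using per[of u] by (simp_all add: add.commute)
  have a2: "G (2 * a + u) = G (4 * \<tau> - 2 + u)" for u
    using minus[of "4 * \<tau> - 2 + u"] by (simp add: a_def n_def algebra_simps)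
  have body: "(\<Sum>s<T. \<Sum>r\<in>row_range. G (2 * r - 1 - 4 * int s) + G (2 * r - 6 + 4 * \<tau> - 4 * int s)) = 2 * int T * C"
    using double[of "- 1 - 4 * int _" "- 6 + 4 * \<tau> - 4 * int _"] by (simp add: algebra_simps)
  have "odd (x_off e + (7 + 2 * int e))" for e by (simp add: x_off_def)
  then have extra: "(\<Sum>e<E. \<Sum>r\<in>row_range. G (2 * r + x_off e) + G (2 * r + 7 + 2 * int e)) = 2 * int E * C"
    using double[of "x_off _" "7 + 2 * int _"] by (simp add: algebra_simps)
  have half: "(\<Sum>r=x..<x + int h. G (2 * r + 4)) + (\<Sum>r=y..<y + int h. G (2 * r + 3)) = C" for x y
    unfolding C_def n using per[unfolded n] by (intro sum_half_period) simp_all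
  \<comment> \<open>For even g each shift occupies h rows and covers one parity class. For odd g the
    even shift is one row short: symbol \<open>2 a + 4\<close> is missing and \<open>2 a + 3\<close>
    is doubled.\<close>
  have Q: "(\<Sum>r\<in>row_range. if r < a then G (2 * r + 4) else G (2 * r + 3)) =
      C + (if int g = 1 \<or> int g = 3 then G (2 * a + 3) - G (2 * a + 4) else 0)"
  proof (cases "int g = 1 \<or> int g = 3")
    case False
    have "int g - 1 + int h = a" using False unfolding h_def by (rule_tac regimes) simp_all
    moreover from this have "int g - 1 + int n = a + int h" by (simp add: n)
    ultimately show ?thesis
      using half[of "int g - 1" a] False unfolding sum_row_range_split by simp
  next
    case True
    have a: "a + 1 = int g - 1 + int h" using True unfolding h_def by (rule_tac regimes) simp_all
    have "{int g - 1..<a + 1} = insert a {int g - 1..<a}"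
      "{a..<int g - 1 + int n} = insert (a + int h) {a..<a + int h}"
      using special_rows(9) a by (auto simp: n)
    moreover have "G (2 * (a + int h) + 3) = G (2 * a + 3)"
      using minus[of "2 * a + 3"] by (simp add: n algebra_simps)
    ultimately show ?thesis
      using half[of "int g - 1" a] True unfolding sum_row_range_split a[symmetric] by simp
  qed
  have zero: "G (2 * row0 + u) = G u" for u
    using per[of u] per[of "u + int n"] by (rule_tac regimes) (simp_all add: algebra_simps)
  have row0: "(\<Sum>s<T. G (2 * row0 + 1 - 4 * int s) - G (2 * row0 - 6 + 4 * \<tau> - 4 * int s))
      = (\<Sum>s<T. G (1 - 4 * int s) - G (- 6 + 4 * \<tau> - 4 * int s))"
    "(\<Sum>e<E. G (2 * row0 + 9 + 2 * int e) - G (2 * row0 + 7 + 2 * int e))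
      = (\<Sum>e<E. G (9 + 2 * int e) - G (7 + 2 * int e))"
    using zero[of "1 - 4 * int _"] zero[of "- 6 + 4 * \<tau> - 4 * int _"]
      zero[of "9 + 2 * int _"] zero[of "7 + 2 * int _"]
    by (simp_all add: algebra_simps)
  have odd: "(\<Sum>s<odd_chain_length. G (2 * (4 * int T + int g + 1 + 2 * int s) + 1 - 4 * int T)
        - G (2 * (4 * int T + int g + 1 + 2 * int s) + 3 - 4 * int T))
      = (\<Sum>s<odd_chain_length. G (3 - 4 * int T + 4 * int s) - G (5 - 4 * int T + 4 * int s))"
    using minus[of "3 - 4 * int T + 4 * int _"] minus[of "5 - 4 * int T + 4 * int _"]
    by (simp add: n_def algebra_simps)
  have even: "(\<Sum>s<T. G (2 * (2 * int T + int g - 2 + 2 * \<tau> + 2 * int s) + 2)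
        - G (2 * (2 * int T + int g - 2 + 2 * \<tau> + 2 * int s) + 4))
      = (\<Sum>s<T. G (- 2 + 4 * \<tau> - 4 * int T + 4 * int s) - G (4 * \<tau> - 4 * int T + 4 * int s))"
    using minus[of "- 2 + 4 * \<tau> - 4 * int T + 4 * int _"] minus[of "4 * \<tau> - 4 * int T + 4 * int _"]
    by (simp add: n_def algebra_simps)
  have rev: "(\<Sum>s<T. G (1 - 4 * int s)) = (\<Sum>s<T. G (5 - 4 * int T + 4 * int s))"
    "(\<Sum>s<T. G (- 1 - 4 * int s)) = (\<Sum>s<T. G (3 - 4 * int T + 4 * int s))"
    "(\<Sum>s<T. G (- 6 + 4 * \<tau> - 4 * int s)) = (\<Sum>s<T. G (- 2 + 4 * \<tau> - 4 * int T + 4 * int s))"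
    "(\<Sum>s<T. G (- 4 + 4 * \<tau> - 4 * int s)) = (\<Sum>s<T. G (4 * \<tau> - 4 * int T + 4 * int s))"
    using sum_reverse_steps[of G 1 T] sum_reverse_steps[of G "- 1" T]
      sum_reverse_steps[of G "- 6 + 4 * \<tau>" T] sum_reverse_steps[of G "- 4 + 4 * \<tau>" T]
    by (simp_all add: algebra_simps)
  have tail: "(\<Sum>s<odd_chain_length. G (3 - 4 * int T + 4 * int s) - G (5 - 4 * int T + 4 * int s))
      + (\<Sum>s<T. G (5 - 4 * int T + 4 * int s) - G (3 - 4 * int T + 4 * int s))
      = (1 - \<tau>) * (G 1 - G (- 1))"
    using special_rows(4)
  proof
    assume "\<tau> = 1"
    then have "odd_chain_length = T" using odd_chain_length_eq by simp
    then show ?thesis using \<open>\<tau> = 1\<close> by (simp add: sum_subtractf)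
  next
    assume "\<tau> = 0"
    then have odd_chain_length: "T = Suc odd_chain_length" using odd_chain_length_eq by simp
    have "(\<Sum>s<T. F s) = (\<Sum>s<odd_chain_length. F s) + F odd_chain_length" for F :: "nat \<Rightarrow> int"
      by (subst odd_chain_length) (rule sum.lessThan_Suc)
    moreover have "G (5 - 4 * int T + 4 * int odd_chain_length) = G 1" "G (3 - 4 * int T + 4 * int odd_chain_length) = G (- 1)"
      by (rule arg_cong[of _ _ G], use odd_chain_length_eq \<open>\<tau> = 0\<close> in linarith)+
    ultimately show ?thesis
      using \<open>\<tau> = 0\<close> by (simp add: sum_subtractf)
  qed
  \<comment> \<open>The move in row \<open>a\<close> lowers 1 to -1 if \<open>\<tau> = 0\<close>,
    which is the remainder of \<open>tail\<close>, and 5 to 3 if \<open>\<tau> = 1\<close>, which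
    undoes the defect of \<open>TQ\<close> in row 0.\<close>
  have last: "G (2 * a + 1) - G (2 * a + 3) + (1 - \<tau>) * (G 1 - G (- 1)) + \<tau> * (G 5 - G 3) = 0"
    using special_rows(4) unfolding a2 by auto
  \<comment> \<open>For odd g the cell in the switched intercalate turns the doubled symbol
    \<open>2 a + 3\<close> into the missing \<open>2 a + 4\<close>.\<close>
  have flips: "(if int g = 1 \<or> int g = 3 then G (2 * a + 3) - G (2 * a + 4) else 0)
      + (if int g = 1 then G 2 - G 1 else if int g = 3 then G 6 - G 5 else 0) = 0"
    unfolding a2 by (rule regimes) simp_all
  have "(\<Sum>r\<in>row_range. \<Sum>t\<in>tags T E. G (2 * r + off r t + defect_of r t)) = (2 * int T + 2 * int E + 1) * C
    + ((if int g = 1 \<or> int g = 3 then G (2 * a + 3) - G (2 * a + 4) else 0)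
      + (if int g = 1 then G 2 - G 1 else if int g = 3 then G 6 - G 5 else 0))
    + (G (2 * a + 1) - G (2 * a + 3) + (1 - \<tau>) * (G 1 - G (- 1)) + \<tau> * (G 5 - G 3))"
  proof -
    have arg: "G (2 * 2 - 8 + 4 * \<tau> - u) = G (- 4 + 4 * \<tau> - u)" "G (2 * 2 - 1 - u) = G (3 - u)"
      "G (2 * 2 + 5 + u) = G (9 + u)" "G (2 * 2 + 7 + u) = G (11 + u)" for u
      by (rule arg_cong[of _ _ G], linarith)+
    have split2: "(\<Sum>e<E. G (11 + 2 * int e) + G (7 + 2 * int e) - 2 * G (9 + 2 * int e))
      = (\<Sum>e<E. G (11 + 2 * int e)) + (\<Sum>e<E. G (7 + 2 * int e)) - 2 * (\<Sum>e<E. G (9 + 2 * int e))"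
      by (simp add: sum_subtractf sum.distrib sum_distrib_left)
    have C3: "(2 * int T + 2 * int E + 1) * C = 2 * int T * C + 2 * int E * C + C"
      by (simp add: algebra_simps)
    show ?thesis
      using tail unfolding defect_sum[of G, OF per] row_sums[of G 2] split2 C3
      unfolding body extra Q row0 odd even arg
      unfolding sum_subtractf rev by linarith
  qed
  then show ?thesis unfolding flips last by (simp add: C_def algebra_simps)
qed

lemma has_kplex_family: "has_kplex n (plex_square n) (2 * T + 1 + 2 * E)"
proof (rule kplex_of_family[where a = "int g - 1" and I = "tags T E" and f = "\<lambda>r t. r + off r t"
      and sy = "\<lambda>r t. r + (r + off r t) + defect_of r t"])
  show "0 < n" using special_rows(12) by simp
  show "finite (tags T E)" by (simp add: tags_def)
  show "card (tags T E) = 2 * T + 1 + 2 * E" by (rule card_tags)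
  show "inj_on (\<lambda>t. (r + off r t) mod int n) (tags T E)" if "int g - 1 \<le> r" "r < int g - 1 + int n" for r
    using that by (rule cells_inj)
  show "int (plex_square n (nat (r mod int n)) (nat ((r + off r t) mod int n))) =
      (r + (r + off r t) + defect_of r t) mod int n"
    if "int g - 1 \<le> r" "r < int g - 1 + int n" "t \<in> tags T E" for r t
    using that by (rule cell_symbol)
next
  fix G :: "int \<Rightarrow> int"
  assume per: "\<And>x. G (x + int n) = G x"
  show "(\<Sum>r=int g - 1..<int g - 1 + int n. \<Sum>t\<in>tags T E. G (r + off r t)) =
      int (2 * T + 1 + 2 * E) * (\<Sum>x=0..<int n. G x)"
    using column_sum[of G, OF per] by (simp add: row_range_def)
  have "r + (r + off r t) + defect_of r t = 2 * r + off r t + defect_of r t" for r t by simp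
  then show "(\<Sum>r=int g - 1..<int g - 1 + int n. \<Sum>t\<in>tags T E. G (r + (r + off r t) + defect_of r t)) =
      int (2 * T + 1 + 2 * E) * (\<Sum>x=0..<int n. G x)"
    using symbol_sum[of G, OF per] by (simp add: row_range_def)
qed

end

section \<open>Small orders and the theorem\<close>

text \<open>A certificate that can be evaluated: the i-th list holds the columns chosen in row
  i.\<close>

definition plex_table :: "nat \<Rightarrow> (nat \<Rightarrow> nat \<Rightarrow> nat) \<Rightarrow> nat \<Rightarrow> nat list list \<Rightarrow> bool" where
  "plex_table n L k rs \<longleftrightarrow>
     length rs = n \<and> list_all (\<lambda>r. length r = k \<and> distinct r \<and> list_all (\<lambda>j. j < n) r) rs \<and>
     (let symbols = concat (map2 (\<lambda>i. map (L i)) [0..<n] rs) in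
       list_all (\<lambda>s. length (filter (\<lambda>x. x = s) (concat rs)) = k \<and>
         length (filter (\<lambda>x. x = s) symbols) = k) [0..<n])"

lemma length_filter_concat:
  "length (filter Q (concat xss)) = (\<Sum>i<length xss. length (filter Q (xss ! i)))"
  by (simp add: filter_concat length_concat sum_list_sum_nth atLeast0LessThan)

lemma has_kplex_of_table:
  assumes "plex_table n L k rs"
  shows "has_kplex n L k"
proof -
  define P where "P = (SIGMA i:{0..<n}. set (rs ! i))"
  have len: "length rs = n"
    and rows: "\<And>r. r \<in> set rs \<Longrightarrow> length r = k \<and> distinct r \<and> set r \<subseteq> {0..<n}"
    and col: "\<And>s. s < n \<Longrightarrow> length (filter (\<lambda>x. x = s) (concat rs)) = k"
    and symbol: "\<And>s. s < n \<Longrightarrow> length (filter (\<lambda>x. x = s) (concat (map2 (\<lambda>i. map (L i)) [0..<n] rs))) = k"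
    using assms by (auto simp: plex_table_def Let_def list_all_iff)
  have row: "length (rs ! i) = k \<and> distinct (rs ! i) \<and> set (rs ! i) \<subseteq> {0..<n}" if "i < n" for i
    using rows nth_mem[of i rs] that len by blast
  have card: "card (set (rs ! i)) = k" if "i < n" for i
    using row[OF that] by (simp add: distinct_card)
  have filter: "length (filter Q (rs ! i)) = card {j \<in> set (rs ! i). Q j}" if "i < n" for i Q
    using row[OF that] by (simp add: distinct_length_filter Int_def conj_commute)
  have cells: "card {c \<in> P. Q (fst c) (snd c)} = (\<Sum>i<n. length (filter (Q i) (rs ! i)))" for Q
  proof -
    have "{c \<in> P. Q (fst c) (snd c)} = (SIGMA i:{0..<n}. {j \<in> set (rs ! i). Q i j})"
      by (auto simp: P_def)
    then show ?thesis using filter by (simp add: atLeast0LessThan)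
  qed
  have "P \<subseteq> {0..<n} \<times> {0..<n}"
    unfolding P_def using row by (intro Sigma_mono) auto
  moreover have "card P = k * n" using card by (simp add: P_def)
  moreover have "card {j. (i, j) \<in> P} = k" if "i < n" for i
    using that card by (simp add: P_def)
  moreover have "card {i. (i, j) \<in> P} = k" if "j < n" for j
  proof -
    have "{c \<in> P. snd c = j} = (\<lambda>i. (i, j)) ` {i. (i, j) \<in> P}" by force
    then have "card {i. (i, j) \<in> P} = card {c \<in> P. snd c = j}"
      by (simp add: card_image inj_on_def)
    then show ?thesis
      using cells[of "\<lambda>_ x. x = j"] col[OF that] len by (simp add: length_filter_concat)
  qed
  moreover have "card {c \<in> P. L (fst c) (snd c) = s} = k" if "s < n" for s
    using cells[of "\<lambda>i x. L i x = s"] symbol[OF that] len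
    by (simp add: length_filter_concat filter_map o_def)
  ultimately show ?thesis unfolding has_kplex_def is_kplex_def by blast
qed

text \<open>The following tables were found with a SAT solver.\<close>

lemma plex_6_3: "has_kplex 6 (plex_square 6) 3"
proof (rule has_kplex_of_table)
  show "plex_table 6 (plex_square 6) 3
    [[0, 1, 2],
     [0, 4, 5],
     [1, 3, 4],
     [1, 2, 5],
     [0, 2, 3],
     [3, 4, 5]]"
    by code_simp
qed

lemma plex_10_3: "has_kplex 10 (plex_square 10) 3"
proof (rule has_kplex_of_table)
  show "plex_table 10 (plex_square 10) 3
    [[2, 4, 6],
     [2, 3, 5],
     [1, 3, 7],
     [1, 2, 5],
     [5, 6, 7],
     [6, 7, 8],
     [0, 4, 9],
     [3, 4, 8],
     [0, 1, 9],
     [0, 8, 9]]"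
    by code_simp
qed

lemma plex_10_5: "has_kplex 10 (plex_square 10) 5"
proof (rule has_kplex_of_table)
  show "plex_table 10 (plex_square 10) 5
    [[1, 4, 5, 6, 7],
     [0, 2, 4, 5, 9],
     [2, 4, 5, 6, 8],
     [1, 2, 4, 5, 9],
     [0, 1, 6, 7, 9],
     [3, 5, 6, 7, 8],
     [3, 6, 7, 8, 9],
     [0, 1, 2, 3, 4],
     [0, 1, 3, 8, 9],
     [0, 2, 3, 7, 8]]"
    by code_simp
qed

lemma plex_18_9: "has_kplex 18 (plex_square 18) 9"
proof (rule has_kplex_of_table)
  show "plex_table 18 (plex_square 18) 9
    [[1, 4, 5, 9, 10, 13, 14, 15, 17],
     [0, 5, 7, 8, 9, 13, 14, 15, 16],
     [2, 6, 7, 8, 10, 12, 13, 14, 16],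
     [2, 5, 9, 10, 11, 14, 15, 16, 17],
     [0, 3, 5, 8, 9, 11, 12, 16, 17],
     [0, 1, 4, 7, 11, 12, 13, 15, 17],
     [0, 1, 2, 5, 10, 12, 13, 14, 15],
     [0, 1, 2, 3, 6, 11, 14, 15, 16],
     [0, 2, 3, 4, 6, 7, 9, 15, 16],
     [2, 3, 4, 5, 8, 12, 14, 16, 17],
     [0, 1, 3, 4, 6, 9, 12, 13, 17],
     [0, 1, 4, 5, 6, 7, 8, 10, 14],
     [1, 2, 3, 4, 6, 7, 8, 11, 15],
     [2, 3, 7, 8, 9, 11, 12, 16, 17],
     [3, 4, 6, 7, 8, 9, 10, 13, 17],
     [0, 4, 5, 9, 10, 11, 13, 14, 17],
     [1, 3, 5, 6, 8, 10, 11, 12, 15],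
     [1, 2, 6, 7, 10, 11, 12, 13, 16]]"
    by code_simp
qed

section \<open>All odd k between n/4 and 3n/4\<close>

lemma has_kplex_le_half:
  assumes n: "even n" "2 < n" and k: "odd k" "n div 4 \<le> k" "k \<le> n div 2"
  shows "has_kplex n (plex_square n) k"
proof -
  define T where "T = n div 8"
  define g where "g = n mod 8 div 2"
  define E where "E = (k - 1) div 2 - T"
  have "even (n mod 8)" using n(1) by (simp add: dvd_mod_iff)
  then have "n mod 8 = 2 * g" by (simp add: g_def)
  then have nT: "n = 8 * T + 2 * g" unfolding T_def by (metis mult_div_mod_eq)
  have g: "g < 4" unfolding g_def by (simp add: less_mult_imp_div_less)
  obtain w where w: "k = 2 * w + 1" using k(1) by (rule oddE)
  \<comment> \<open>An odd k that is at least 2T is at least 2T + 1, so E is not truncated.\<close>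
  have "2 * T \<le> n div 4" unfolding nT by simp
  then have "T \<le> w" using k(2) w by linarith
  then have kT: "k = 2 * T + 1 + 2 * E" unfolding E_def w by simp
  have T_pos: "1 \<le> T" if "g < 2" using n(2) nT that by linarith
  have E_le: "2 * E < 2 * T + g" using k(3) kT nT by linarith
  show ?thesis
  proof (cases "(T, g, E) \<in> {(0, 3, 1), (1, 1, 0), (1, 1, 1), (2, 1, 2)}")
    case True
    then have "n = 6 \<and> k = 3 \<or> n = 10 \<and> k = 3 \<or> n = 10 \<and> k = 5 \<or> n = 18 \<and> k = 9"
      using nT kT by auto
    then show ?thesis using plex_6_3 plex_10_3 plex_10_5 plex_18_9 by blast
  next
    case False
    then interpret plex_family T g E
      using g T_pos E_le by unfold_locales
    show ?thesis using has_kplex_family by (simp add: n_def nT kT)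
  qed
qed

theorem theorem5p3:
  fixes n :: nat
  assumes "even n" and "n > 2"
  shows "\<exists>L. latin_square n L \<and>
     (\<forall>k. odd k \<longrightarrow>
        (has_kplex n L k \<longleftrightarrow>
           \<lfloor>real n / 4\<rfloor> \<le> int k \<and> int k \<le> \<lceil>3 * real n / 4\<rceil>))"
proof (intro exI conjI allI impI)
  show latin: "latin_square n (plex_square n)"
    using assms by (rule latin_square_plex_square)
  have floor: "\<lfloor>real n / 4\<rfloor> = int (n div 4)"
    using floor_divide_of_nat_eq[of n 4] by simp
  \<comment> \<open>The upper end of the range is n minus the lower end, so the range is invariant
    under complements.\<close>
  have "3 * real n / 4 = - (real n / 4 - real n)" by simp
  then have "\<lceil>3 * real n / 4\<rceil> = - \<lfloor>real n / 4 - real n\<rfloor>"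
    by (simp only: ceiling_minus)
  then have ceiling: "\<lceil>3 * real n / 4\<rceil> = int n - int (n div 4)"
    using floor by linarith
  fix k :: nat
  assume k: "odd k"
  show "has_kplex n (plex_square n) k \<longleftrightarrow>
    \<lfloor>real n / 4\<rfloor> \<le> int k \<and> int k \<le> \<lceil>3 * real n / 4\<rceil>"
  proof
    assume "has_kplex n (plex_square n) k"
    then obtain P where P: "is_kplex n (plex_square n) k P" by (auto simp: has_kplex_def)
    have le: "k \<le> n" using kplex_le[OF P] assms by simp
    have "n div 4 \<le> k" using kplex_ge[OF assms P k] .
    moreover have "n div 4 \<le> n - k"
      using kplex_ge[OF assms is_kplex_complement[OF latin P]] k le assms by simp
    ultimately show "\<lfloor>real n / 4\<rfloor> \<le> int k \<and> int k \<le> \<lceil>3 * real n / 4\<rceil>"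
      using le unfolding floor ceiling by linarith
  next
    assume "\<lfloor>real n / 4\<rfloor> \<le> int k \<and> int k \<le> \<lceil>3 * real n / 4\<rceil>"
    then have range: "n div 4 \<le> k" "k \<le> n - n div 4"
      unfolding floor ceiling by linarith+
    show "has_kplex n (plex_square n) k"
    proof (cases "k \<le> n div 2")
      case True
      then show ?thesis using has_kplex_le_half[OF assms k range(1)] by simp
    next
      case False
      \<comment> \<open>For k above n/2 take the complement of an (n - k)-plex; n - k is odd because
        n is even.\<close>
      then have "odd (n - k)" "n div 4 \<le> n - k" "n - k \<le> n div 2" "n - (n - k) = k"
        using range k assms by auto
      then show ?thesis
        using has_kplex_le_half[OF assms, of "n - k"] is_kplex_complement[OF latin]
        unfolding has_kplex_def by metis
    qed
  qed
qed

end
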